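(* Let $P=(D,\psi)$ be a distribution over examples in $X\times\{-1,1\}$, let $\chi:X\to[0,1]$ be a filter function and $\phi:X\times\{-1,1\}\to[-1,1]$ a query function, let $\eta\in[0,1/2)$, $\tau>0$, and let $\Lambda:X\to[0,1]$ be a noise function that is $(\eta,(1-2\eta)\tau/4)$-uncorrelated with $\phi$ and $\chi$ over $P$, that is, $$\left|\mathbf{E}_{D_{|\chi}}\left[\frac{\phi(x,1)-\phi(x,-1)}{2}\,\psi(x)\cdot\bigl(1-2(\Lambda(x)-\eta)\bigr)\right]\right|\le\frac{(1-2\eta)\tau}{4}.$$ There exists an active sampling algorithm that, given the functions $\chi$ and $\phi$, values $\eta$, $\tau_0>0$, $\tau>0$, $\delta>0$, and access to samples from $P^\Lambda$, with probability at least $1-\delta$ outputs a valid response to the active statistical query $(\chi,\phi)$ with tolerance parameters $(\tau_0,\tau)$. The algorithm uses $O(\tau^{-2}(1-2\eta)^{-2}\log(1/\delta))$ labeled examples from $P^\Lambda$ and $O(\tau_0^{-1}\tau^{-2}(1-2\eta)^{-2}\log(1/\delta))$ unlabeled samples from $D$.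
   Context: A distribution $P$ over labeled examples $X\times\{-1,1\}$ is represented as a pair $(D,\psi)$, where $D$ is the marginal of $P$ on $X$ and $\psi(z)=\mathbf{E}_{(x,\ell)\sim P}[\ell\mid x=z]\in[-1,1]$. For a noise function $\Lambda:X\to[0,1]$, $\Lambda(x)$ is the probability that the label of $x$ is flipped, and $P^\Lambda$ denotes $P$ corrupted by label noise $\Lambda$, i.e. $P^\Lambda=(D,\psi\cdot(1-2\Lambda))$. For a filter $\chi:X\to[0,1]$, $D_{|\chi}$ is the distribution with density $D_{|\chi}(x)=D(x)\chi(x)/\mathbf{E}_D[\chi(x)]$, and $P_{|\chi}=(D_{|\chi},\psi)$. A valid response to the active statistical query $(\chi,\phi)$ with tolerance parameters $(\tau_0,\tau)$ (filter tolerance $\tau_0$ and query tolerance $\tau$), relative to $P$, is a value $\mu$ such that if $\mathbf{E}_D[\chi(x)]\ge\tau_0$ then $|\mu-\mathbf{E}_{P_{|\chi}}[\phi(x,\ell)]|\le\tau$ (nothing is required when $\mathbf{E}_D[\chi(x)]<\tau_0$). Definition: for $\tau'>0$, a noise function $\Lambda$ is $(\eta,\tau')$-uncorrelated with $\phi$ and $\chi$ over $P=(D,\psi)$ if $$\left|\mathbf{E}_{D_{|\chi}}\left[\frac{\phi(x,1)-\phi(x,-1)}{2}\,\psi(x)\cdot\bigl(1-2(\Lambda(x)-\eta)\bigr)\right]\right|\le\tau'.$$ An active sampling algorithm with access to samples from a distribution with marginal $D$ can draw independent unlabeled points $x\sim D$ and, for any drawn point, may request its label, which is drawn from the conditional label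 distribution given $x$. The number of labeled examples is the number of label requests.
   Formalization: In the uncorrelatedness condition the factor 1-2(Λ(x)-η) is replaced by Λ(x)-η, since as printed the claim fails (one point, χ=1, φ(x,l)=l, η=0, Λ=1/2: ψ=0 and ψ=1 give the same samples); also δ<1 is assumed. *)

theory Defs
  imports "HOL-Probability.Probability"
begin

section \<open>Distributions over labeled examples\<close>

text \<open>Labels are the reals \<open>-1\<close> and \<open>1\<close>. The distribution represented by a pair \<open>(D, \<psi>)\<close> has
  marginal \<open>D\<close>, and given the point \<open>x\<close> the label \<open>l\<close> has probability \<open>(1 + l * \<psi> x) / 2\<close>,
  which makes \<open>\<psi> x\<close> the conditional expectation of the label.\<close>

definition labeled_dist :: "'x measure \<Rightarrow> ('x \<Rightarrow> real) \<Rightarrow> ('x \<times> real) measure" where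
  "labeled_dist D \<psi> =
     density (D \<Otimes>\<^sub>M count_space {-1, 1}) (\<lambda>(x, l). ennreal ((1 + l * \<psi> x) / 2))"

definition noisy :: "('x \<Rightarrow> real) \<Rightarrow> ('x \<Rightarrow> real) \<Rightarrow> 'x \<Rightarrow> real" where
  "noisy \<psi> \<Lambda> = (\<lambda>x. \<psi> x * (1 - 2 * \<Lambda> x))"

text \<open>Filters are called \<open>\<kappa>\<close>, since the letter chi is binder syntax for vectors. If \<open>\<kappa>\<close> has
  expectation 0, \<open>filtered D \<kappa>\<close> is the null measure.\<close>

definition filtered :: "'x measure \<Rightarrow> ('x \<Rightarrow> real) \<Rightarrow> 'x measure" where
  "filtered D \<kappa> = density D (\<lambda>x. ennreal (\<kappa> x / (\<integral>y. \<kappa> y \<partial>D)))"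

definition valid_response ::
  "'x measure \<Rightarrow> ('x \<Rightarrow> real) \<Rightarrow> ('x \<Rightarrow> real) \<Rightarrow> ('x \<Rightarrow> real \<Rightarrow> real) \<Rightarrow> real \<Rightarrow> real \<Rightarrow> real \<Rightarrow> bool"
where
  "valid_response D \<psi> \<kappa> \<phi> \<tau>\<^sub>0 \<tau> \<mu> \<longleftrightarrow>
     ((\<integral>x. \<kappa> x \<partial>D) \<ge> \<tau>\<^sub>0 \<longrightarrow>
      \<bar>\<mu> - (\<integral>(x, l). \<phi> x l \<partial>labeled_dist (filtered D \<kappa>) \<psi>)\<bar> \<le> \<tau>)"

text \<open>The deviation of the noise from the constant rate \<open>\<eta>\<close> enters through the factor
  \<open>\<Lambda> x - \<eta>\<close>. The source prints \<open>1 - 2 * (\<Lambda> x - \<eta>)\<close> in its place (\<open>uncorrelated_printed\<close>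
  below), a misprint: that condition does not cover the constant noise rate \<open>\<eta>\<close>, and under it
  the label may carry no information on \<open>\<psi>\<close> at all (\<open>\<Lambda> = 1/2\<close>, \<open>\<eta> = 0\<close>), so that no algorithm
  can succeed; see \<open>printed_condition_fails\<close>. With the factor \<open>\<Lambda> x - \<eta>\<close> and
  \<open>\<tau>' = (1 - 2 * \<eta>) * \<tau> / 4\<close>, the noise displaces the estimate, rescaled by \<open>1 / (1 - 2 * \<eta>)\<close>,
  by at most \<open>\<tau> / 2\<close>. The reading with \<open>(1 - 2 * \<Lambda> x) - (1 - 2 * \<eta>)\<close> is a stronger condition
  on \<open>\<Lambda>\<close>.\<close>

definition uncorrelated ::
  "real \<Rightarrow> real \<Rightarrow> ('x \<Rightarrow> real \<Rightarrow> real) \<Rightarrow> ('x \<Rightarrow> real) \<Rightarrow> 'x measure \<Rightarrow> ('x \<Rightarrow> real) \<Rightarrow>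
   ('x \<Rightarrow> real) \<Rightarrow> bool"
where
  "uncorrelated \<eta> \<tau>' \<phi> \<kappa> D \<psi> \<Lambda> \<longleftrightarrow>
     \<bar>\<integral>x. (\<phi> x 1 - \<phi> x (-1)) / 2 * \<psi> x * (\<Lambda> x - \<eta>) \<partial>filtered D \<kappa>\<bar> \<le> \<tau>'"

definition uncorrelated_printed ::
  "real \<Rightarrow> real \<Rightarrow> ('x \<Rightarrow> real \<Rightarrow> real) \<Rightarrow> ('x \<Rightarrow> real) \<Rightarrow> 'x measure \<Rightarrow> ('x \<Rightarrow> real) \<Rightarrow>
   ('x \<Rightarrow> real) \<Rightarrow> bool"
where
  "uncorrelated_printed \<eta> \<tau>' \<phi> \<kappa> D \<psi> \<Lambda> \<longleftrightarrow>
     \<bar>\<integral>x. (\<phi> x 1 - \<phi> x (-1)) / 2 * \<psi> x * (1 - 2 * (\<Lambda> x - \<eta>)) \<partial>filtered D \<kappa>\<bar> \<le> \<tau>'"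

section \<open>Active sampling algorithms\<close>

text \<open>An algorithm is an interaction tree, adaptive in everything seen so far: it draws the next
  unlabeled point, requests the label of the drawn point number \<open>i\<close> (from 0), or tosses a coin that is
  uniform on \<open>[0, 1]\<close>, until it outputs a value.\<close>

datatype 'x active_alg =
    Output real
  | Draw "'x \<Rightarrow> 'x active_alg"
  | Request nat "real \<Rightarrow> 'x active_alg"
  | Toss "real \<Rightarrow> 'x active_alg"

text \<open>\<open>run t n q k s u\<close> continues with \<open>t\<close> after \<open>n\<close> draws, \<open>q\<close> label requests and \<open>k\<close> tosses,
  where \<open>s\<close> lists the labeled examples and \<open>u\<close> the coins. The result is the output, the total
  number of draws and the total number of label requests. A request for a point that has not
  been drawn is answered by 0; repeated requests for a point get the same answer but each one
  counts.\<close>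

primrec run ::
  "'x active_alg \<Rightarrow> nat \<Rightarrow> nat \<Rightarrow> nat \<Rightarrow> (nat \<Rightarrow> 'x \<times> real) \<Rightarrow> (nat \<Rightarrow> real) \<Rightarrow> real \<times> nat \<times> nat"
where
  "run (Output \<mu>) = (\<lambda>n q k s u. (\<mu>, n, q))"
| "run (Draw f) = (\<lambda>n q k s u. run (f (fst (s n))) (Suc n) q k s u)"
| "run (Request i f) = (\<lambda>n q k s u. run (f (if i < n then snd (s i) else 0)) n (Suc q) k s u)"
| "run (Toss f) = (\<lambda>n q k s u. run (f (u k)) n q (Suc k) s u)"

definition answer :: "'x active_alg \<Rightarrow> (nat \<Rightarrow> 'x \<times> real) \<times> (nat \<Rightarrow> real) \<Rightarrow> real" where
  "answer t = (\<lambda>(s, u). fst (run t 0 0 0 s u))"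

definition draws :: "'x active_alg \<Rightarrow> (nat \<Rightarrow> 'x \<times> real) \<times> (nat \<Rightarrow> real) \<Rightarrow> nat" where
  "draws t = (\<lambda>(s, u). fst (snd (run t 0 0 0 s u)))"

definition label_requests :: "'x active_alg \<Rightarrow> (nat \<Rightarrow> 'x \<times> real) \<times> (nat \<Rightarrow> real) \<Rightarrow> nat" where
  "label_requests t = (\<lambda>(s, u). snd (snd (run t 0 0 0 s u)))"

text \<open>Independent labeled examples from \<open>P\<close> and independent uniform coins.\<close>

definition sampling_space ::
  "('x \<times> real) measure \<Rightarrow> ((nat \<Rightarrow> 'x \<times> real) \<times> (nat \<Rightarrow> real)) measure"
where
  "sampling_space P =
     (\<Pi>\<^sub>M i\<in>UNIV. P) \<Otimes>\<^sub>M (\<Pi>\<^sub>M i\<in>UNIV. uniform_measure lborel {0..1})"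

section \<open>Basic properties\<close>

lemma measurable_label_density:
  assumes "\<psi> \<in> borel_measurable D"
  shows "(\<lambda>(x, l). ennreal ((1 + l * \<psi> x) / 2))
           \<in> borel_measurable (D \<Otimes>\<^sub>M count_space {-1, 1})"
proof -
  have [measurable]: "\<psi> \<in> borel_measurable D" by fact
  have [measurable]: "(\<lambda>l. l) \<in> borel_measurable (count_space {-1, 1::real})" by simp
  have [measurable]: "snd \<in> borel_measurable (D \<Otimes>\<^sub>M count_space {-1, 1::real})"
    using measurable_compose[OF measurable_snd, of "\<lambda>l. l" "count_space {-1, 1::real}" borel D]
    by simp
  show ?thesis unfolding case_prod_beta by measurable
qed

lemma nn_integral_labeled_dist:
  assumes psi: "\<psi> \<in> borel_measurable D"
    and f[measurable]: "f \<in> borel_measurable (D \<Otimes>\<^sub>M count_space {-1, 1})"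
  shows "(\<integral>\<^sup>+ z. f z \<partial>labeled_dist D \<psi>) =
    (\<integral>\<^sup>+ x. ennreal ((1 + \<psi> x) / 2) * f (x, 1) + ennreal ((1 - \<psi> x) / 2) * f (x, -1) \<partial>D)"
proof -
  interpret sigma_finite_measure "count_space {-1, 1::real}"
    by (rule sigma_finite_measure_count_space_finite) simp
  have [measurable]: "(\<lambda>z. case z of (x, l) \<Rightarrow> ennreal ((1 + l * \<psi> x) / 2))
      \<in> borel_measurable (D \<Otimes>\<^sub>M count_space {-1, 1})"
    using measurable_label_density[OF psi] .
  have "(\<integral>\<^sup>+ z. f z \<partial>labeled_dist D \<psi>) =
    (\<integral>\<^sup>+ z. (case z of (x, l) \<Rightarrow> ennreal ((1 + l * \<psi> x) / 2)) * f z
       \<partial>(D \<Otimes>\<^sub>M count_space {-1, 1}))"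
    unfolding labeled_dist_def by (rule nn_integral_density) measurable
  also have "\<dots> = (\<integral>\<^sup>+ x. \<integral>\<^sup>+ l. ennreal ((1 + l * \<psi> x) / 2) * f (x, l)
       \<partial>count_space {-1, 1} \<partial>D)"
    by (subst nn_integral_fst[symmetric]) auto
  also have "\<dots> = (\<integral>\<^sup>+ x. ennreal ((1 + \<psi> x) / 2) * f (x, 1)
       + ennreal ((1 - \<psi> x) / 2) * f (x, -1) \<partial>D)"
    by (intro nn_integral_cong, subst nn_integral_count_space_finite) (auto simp: add.commute)
  finally show ?thesis .
qed

lemma sets_labeled_dist [simp]:
  "sets (labeled_dist D \<psi>) = sets (D \<Otimes>\<^sub>M count_space {-1, 1})"
  by (simp add: labeled_dist_def)

lemma space_labeled_dist [simp]: "space (labeled_dist D \<psi>) = space D \<times> {-1, 1}"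
  by (simp add: labeled_dist_def space_pair_measure)

lemma distr_fst_labeled_dist:
  assumes psi: "\<psi> \<in> borel_measurable D" and bnd: "\<And>x. x \<in> space D \<Longrightarrow> \<psi> x \<in> {-1..1}"
  shows "distr (labeled_dist D \<psi>) D fst = D"
proof (rule measure_eqI)
  fix A assume "A \<in> sets (distr (labeled_dist D \<psi>) D fst)"
  then have A[measurable]: "A \<in> sets D" by simp
  have m: "fst \<in> measurable (labeled_dist D \<psi>) D"
    by (simp add: measurable_fst measurable_cong_sets[OF sets_labeled_dist refl])
  have "emeasure (distr (labeled_dist D \<psi>) D fst) A =
      (\<integral>\<^sup>+ z. indicator A (fst z) \<partial>labeled_dist D \<psi>)"
    using m A by (simp flip: nn_integral_indicator add: nn_integral_distr)
  also have "\<dots> = (\<integral>\<^sup>+ x. ennreal ((1 + \<psi> x) / 2) * indicator A x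
      + ennreal ((1 - \<psi> x) / 2) * indicator A x \<partial>D)"
    by (subst nn_integral_labeled_dist[OF psi]) auto
  also have "\<dots> = (\<integral>\<^sup>+ x. indicator A x \<partial>D)"
  proof (intro nn_integral_cong)
    fix x assume "x \<in> space D"
    then have "ennreal ((1 + \<psi> x) / 2) + ennreal ((1 - \<psi> x) / 2) = 1"
      using bnd[of x] by (subst ennreal_plus[symmetric]) (auto simp: field_simps)
    then show "ennreal ((1 + \<psi> x) / 2) * indicator A x + ennreal ((1 - \<psi> x) / 2) * indicator A x
        = (indicator A x :: ennreal)"
      by (simp flip: distrib_right)
  qed
  also have "\<dots> = emeasure D A" by simp
  finally show "emeasure (distr (labeled_dist D \<psi>) D fst) A = emeasure D A" .
qed simp

lemma prob_space_labeled_dist: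
  assumes D: "prob_space D" and psi: "\<psi> \<in> borel_measurable D"
    and bnd: "\<And>x. x \<in> space D \<Longrightarrow> \<psi> x \<in> {-1..1}"
  shows "prob_space (labeled_dist D \<psi>)"
proof -
  have m: "fst \<in> measurable (labeled_dist D \<psi>) D"
    by (simp add: measurable_fst measurable_cong_sets[OF sets_labeled_dist refl])
  have "prob_space (distr (labeled_dist D \<psi>) D fst)"
    using distr_fst_labeled_dist[OF psi bnd] D by simp
  then show ?thesis using prob_space_distrD[OF m] by blast
qed

lemma prob_space_sampling_space:
  assumes "prob_space P"
  shows "prob_space (sampling_space P)"
proof -
  have "prob_space (uniform_measure lborel {0..1::real})"
    by (rule prob_space_uniform_measure) auto
  then show ?thesis
    unfolding sampling_space_def by (intro prob_space_pair prob_space_PiM assms)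
qed

text \<open>Under the printed condition no algorithm works, whatever its sample complexity.\<close>

lemma printed_condition_fails:
  "\<not> (\<exists>A :: ('x \<Rightarrow> real) \<Rightarrow> ('x \<Rightarrow> real \<Rightarrow> real) \<Rightarrow> real \<Rightarrow> real \<Rightarrow> real \<Rightarrow> real \<Rightarrow> 'x active_alg.
     \<forall>(D :: 'x measure) \<psi> \<kappa> \<phi> \<Lambda> \<eta> \<tau>\<^sub>0 \<tau> \<delta>.
       prob_space D \<and>
       \<psi> \<in> borel_measurable D \<and> (\<forall>x\<in>space D. \<psi> x \<in> {-1..1}) \<and>
       \<kappa> \<in> borel_measurable D \<and> (\<forall>x\<in>space D. \<kappa> x \<in> {0..1}) \<and>
       case_prod \<phi> \<in> borel_measurable (D \<Otimes>\<^sub>M count_space {-1, 1}) \<and>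
       (\<forall>x\<in>space D. \<forall>l\<in>{-1, 1}. \<phi> x l \<in> {-1..1}) \<and>
       \<Lambda> \<in> borel_measurable D \<and> (\<forall>x\<in>space D. \<Lambda> x \<in> {0..1}) \<and>
       0 \<le> \<eta> \<and> \<eta> < 1/2 \<and> 0 < \<tau>\<^sub>0 \<and> 0 < \<tau> \<and> 0 < \<delta> \<and> \<delta> < 1 \<and>
       uncorrelated_printed \<eta> ((1 - 2 * \<eta>) * \<tau> / 4) \<phi> \<kappa> D \<psi> \<Lambda> \<longrightarrow>
       measure (sampling_space (labeled_dist D (noisy \<psi> \<Lambda>)))
         {\<omega> \<in> space (sampling_space (labeled_dist D (noisy \<psi> \<Lambda>))).
            valid_response D \<psi> \<kappa> \<phi> \<tau>\<^sub>0 \<tau> (answer (A \<kappa> \<phi> \<eta> \<tau>\<^sub>0 \<tau> \<delta>) \<omega>)} \<ge> 1 - \<delta>)"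
  (is "\<not> (\<exists>A. ?Works A)")
proof
  assume "\<exists>A. ?Works A"
  then obtain A :: "('x \<Rightarrow> real) \<Rightarrow> ('x \<Rightarrow> real \<Rightarrow> real) \<Rightarrow> real \<Rightarrow> real \<Rightarrow> real \<Rightarrow> real \<Rightarrow> 'x active_alg"
    where A: "?Works A" by blast
  define D :: "'x measure" where "D = return (count_space UNIV) undefined"
  define \<kappa> :: "'x \<Rightarrow> real" where "\<kappa> = (\<lambda>_. 1)"
  define \<phi> :: "'x \<Rightarrow> real \<Rightarrow> real" where "\<phi> = (\<lambda>_ l. l)"
  define P where "P = labeled_dist D (\<lambda>_. 0)"
  define Q where "Q = sampling_space P"
  define t where "t = A \<kappa> \<phi> 0 1 (1/4) (1/4)"
  have D: "prob_space D" unfolding D_def by (rule prob_space_return) simp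
  then interpret D: prob_space D .
  have fD: "filtered D \<kappa> = D"
    by (simp add: filtered_def \<kappa>_def density_1 D.prob_space)
  have Q: "prob_space Q" unfolding Q_def P_def
    by (intro prob_space_sampling_space prob_space_labeled_dist D) auto
  then interpret Q: prob_space Q .
  have phi_m: "case_prod \<phi> \<in> borel_measurable (D \<Otimes>\<^sub>M count_space {-1, 1})"
    using measurable_compose[OF measurable_snd, of "\<lambda>l. l" "count_space {-1, 1::real}" borel D]
    by (simp add: \<phi>_def case_prod_beta)
  have mean: "(\<integral>(x, l). \<phi> x l \<partial>labeled_dist D (\<lambda>_. c)) = c" if c: "c \<in> {-1..1}" for c :: real
  proof -
    interpret sigma_finite_measure "count_space {-1, 1::real}"
      by (rule sigma_finite_measure_count_space_finite) simp
    interpret L: prob_space "labeled_dist D (\<lambda>_. c)"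
      using c by (intro prob_space_labeled_dist D) auto
    have m: "case_prod \<phi> \<in> borel_measurable (labeled_dist D (\<lambda>_. c))"
      using phi_m by (simp add: measurable_cong_sets[OF sets_labeled_dist refl])
    have int: "integrable (labeled_dist D (\<lambda>_. c)) (case_prod \<phi>)"
      by (rule L.integrable_const_bound[where B = 1, OF _ m], rule AE_I2) (auto simp: \<phi>_def)
    have "(\<integral>z. case_prod \<phi> z + 1 \<partial>labeled_dist D (\<lambda>_. c)) =
        enn2real (\<integral>\<^sup>+ z. ennreal (case_prod \<phi> z + 1) \<partial>labeled_dist D (\<lambda>_. c))"
      using m by (intro integral_eq_nn_integral) (auto intro!: AE_I2 simp: \<phi>_def)
    also have "(\<integral>\<^sup>+ z. ennreal (case_prod \<phi> z + 1) \<partial>labeled_dist D (\<lambda>_. c)) =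
        (\<integral>\<^sup>+ x. ennreal (1 + c) \<partial>D)"
    proof -
      have "(1 + c) / 2 * 2 = 1 + c" by simp
      then have "ennreal ((1 + c) / 2) * 2 = ennreal (1 + c)"
        using c ennreal_mult[of "(1 + c) / 2" 2] by (metis atLeastAtMost_iff ennreal_numeral
          le_minus_iff zero_le_numeral add.commute diff_ge_0_iff_ge diff_minus_eq_add
          divide_nonneg_pos zero_less_numeral)
      moreover have "(\<lambda>z. ennreal (case_prod \<phi> z + 1))
          \<in> borel_measurable (D \<Otimes>\<^sub>M count_space {-1, 1})"
        using phi_m by measurable
      ultimately show ?thesis
        by (subst nn_integral_labeled_dist) (simp_all add: \<phi>_def)
    qed
    also have "\<dots> = ennreal (1 + c)"
      using D.emeasure_space_1 by simp
    finally have "(\<integral>z. case_prod \<phi> z + 1 \<partial>labeled_dist D (\<lambda>_. c)) = 1 + c" using c by simp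
    then show ?thesis using int L.prob_space by simp
  qed
  have valid: "valid_response D (\<lambda>_. c) \<kappa> \<phi> 1 (1/4) \<mu> \<longleftrightarrow> \<bar>\<mu> - c\<bar> \<le> 1/4"
    if "c \<in> {-1..1}" for c \<mu> :: real
    using mean[OF that] by (simp add: valid_response_def fD, simp add: \<kappa>_def D.prob_space)
  have success: "measure Q {\<omega> \<in> space Q. \<bar>answer t \<omega> - c\<bar> \<le> 1/4} \<ge> 3/4"
    if c: "c \<in> {-1..1}" for c :: real
    using A[rule_format, of D "\<lambda>_. c" \<kappa> \<phi> "\<lambda>_. 1/2" 0 1 "1/4" "1/4"] D c phi_m
    by (simp add: uncorrelated_printed_def noisy_def valid flip: P_def Q_def t_def)
       (simp add: \<kappa>_def \<phi>_def)
  let ?S = "\<lambda>c. {\<omega> \<in> space Q. \<bar>answer t \<omega> - c\<bar> \<le> 1/4}"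
  have ev: "?S c \<in> Q.events" if "c \<in> {-1..1}" for c
    using success[OF that] measure_notin_sets[of "?S c" Q] by fastforce
  have "Q.prob (?S 0) + Q.prob (?S 1) = Q.prob (?S 0 \<union> ?S 1)"
    by (rule Q.finite_measure_Union[symmetric, OF ev ev]) auto
  also have "\<dots> \<le> 1" by (rule Q.prob_le_1)
  finally show False using success[of 0] success[of 1] by simp
qed

end

theory Submission
  imports Defs
begin

text \<open>Draw points, accept \<open>x\<close> with probability \<open>\<kappa> x\<close>, and request labels of the first \<open>m\<close> accepted
  points only, which are distributed according to \<open>filtered D \<kappa>\<close>. Write \<open>\<phi> x l = a x + b x * l\<close>.
  The mean of \<open>a x + b x * l / (1 - 2 * \<eta>)\<close> under noisy labels differs from the mean of \<open>\<phi>\<close> under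
  clean labels by the correlation term times \<open>2 / (1 - 2 * \<eta>)\<close>, so by at most \<open>\<tau> / 2\<close>; averaging controls
  the rest. The stopping at \<open>m\<close> accepted points is handled by exponential supermartingales
  \<open>V\<close> of the pair (number accepted, running sum): one of Hoeffding type for the sum, one of
  Chernoff type showing that \<open>4 * m / \<tau>\<^sub>0\<close> draws suffice to accept \<open>m\<close> points.\<close>

text \<open>Both sample bounds are pure multiples of \<open>ln (1 / \<delta>)\<close> without an
  additive constant, and both hold for every \<omega>, not just with high probability. The second
  fact rules out drawing until \<open>m\<close> points are accepted: the number of draws is fixed in
  advance, drawing goes on after the last acceptance, and accepting too few points is one of the
  failure events. The first fact forces a separate treatment of \<delta> near 1. Where the bound is
  below one label, no label may be requested at all, and the small success probability required must
  come from randomizing the output; this is why the estimator tosses one coin before it samples. The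
  accepted points sit at random positions of the stream. They are never shown to be an independent
  sample from \<open>filtered D \<kappa>\<close>. It is enough that, from every state, the mean of
  \<open>V\<close> after one round is at most a factor \<theta> times its present value; Fubini on
  the product space then iterates this over the rounds, and frozen states only have to satisfy the
  same inequality.\<close>

section \<open>The sampling algorithm and the walk it follows\<close>

text \<open>The test \<open>N < m\<close> freezes the state, so once the count has reached
  \<open>m\<close> the sum has exactly \<open>m\<close> terms, whatever the number of draws.\<close>

definition step :: "('a \<Rightarrow> real) \<Rightarrow> ('a \<Rightarrow> real) \<Rightarrow> nat \<Rightarrow> nat \<times> real \<Rightarrow> 'a \<Rightarrow> real \<Rightarrow> nat \<times> real" where
  "step \<kappa> g m = (\<lambda>(N, T) z c. if N < m \<and> c \<le> \<kappa> z then (Suc N, T + g z) else (N, T))"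

primrec walk :: "('a \<Rightarrow> real) \<Rightarrow> ('a \<Rightarrow> real) \<Rightarrow> nat \<Rightarrow> nat \<Rightarrow> nat \<times> real \<Rightarrow> (nat \<Rightarrow> 'a) \<Rightarrow> (nat \<Rightarrow> real) \<Rightarrow>
  nat \<times> real" where
  "walk \<kappa> g m 0 st s u = st"
| "walk \<kappa> g m (Suc k) st s u = step \<kappa> g m (walk \<kappa> g m k st s u) (s k) (u k)"

text \<open>\<open>walk\<close> recurses on the last round, whereas \<open>sampler\<close> and the
  integral over an infinite product split off the first one. This lemma mediates.\<close>

lemma walk_Suc_front:
  "walk \<kappa> g m (Suc k) st s u =
     walk \<kappa> g m k (step \<kappa> g m st (s 0) (u 0)) (\<lambda>i. s (Suc i)) (\<lambda>i. u (Suc i))"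
  by (induction k) auto

text \<open>Each round makes one draw and one toss even when the state is frozen, so round
  \<open>r\<close> always uses example \<open>i + r\<close> and coin \<open>j + r\<close>. The
  argument \<open>i\<close> counts the draws made before the round, hence is the index of the point
  just drawn, and the request for it is never answered by the default 0.\<close>

primrec sampler :: "('x \<Rightarrow> real) \<Rightarrow> ('x \<Rightarrow> real \<Rightarrow> real) \<Rightarrow> nat \<Rightarrow> (real \<Rightarrow> real) \<Rightarrow> nat \<Rightarrow> nat \<Rightarrow>
  nat \<Rightarrow> real \<Rightarrow> 'x active_alg" where
  "sampler \<kappa> g m h 0 i N T = Output (h T)"
| "sampler \<kappa> g m h (Suc k) i N T = Draw (\<lambda>x. Toss (\<lambda>c.
     if N < m \<and> c \<le> \<kappa> x
     then Request i (\<lambda>l. sampler \<kappa> g m h k (Suc i) (Suc N) (T + g x l))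
     else sampler \<kappa> g m h k (Suc i) N T))"

lemma draws_run_sampler: "fst (snd (run (sampler \<kappa> g m h k i N T) i q j s u)) = i + k"
  by (induction k arbitrary: i N T q j) auto

lemma requests_run_sampler: "snd (snd (run (sampler \<kappa> g m h k i N T) i q j s u)) \<le> q + (m - N)"
proof (induction k arbitrary: i N T q j)
  case (Suc k)
  show ?case
    using Suc.IH[of "Suc i" "Suc N" _ "Suc q" "Suc j"] Suc.IH[of "Suc i" N T q "Suc j"]
    by (auto intro!: order_trans[OF Suc.IH])
qed auto

lemma fst_run_sampler:
  "fst (run (sampler \<kappa> g m h k i N T) i q j s u) =
     h (snd (walk (\<kappa> \<circ> fst) (case_prod g) m k (N, T) (\<lambda>r. s (i + r)) (\<lambda>r. u (j + r))))"
proof (induction k arbitrary: i N T q j)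
  case (Suc k)
  then show ?case
    by (auto simp: walk_Suc_front step_def case_prod_beta simp del: walk.simps)
qed auto

text \<open>The first coin is reserved for randomizing the output through \<open>h\<close>; the
  acceptance tests use the later coins, which explains the shift by \<open>Suc\<close> in
  \<open>answer_estimator\<close>.\<close>

definition estimator :: "('x \<Rightarrow> real) \<Rightarrow> ('x \<Rightarrow> real \<Rightarrow> real) \<Rightarrow> nat \<Rightarrow> nat \<Rightarrow> (real \<Rightarrow> real \<Rightarrow> real) \<Rightarrow>
  'x active_alg" where
  "estimator \<kappa> g m n h = Toss (\<lambda>b. sampler \<kappa> g m (h b) n 0 0 0)"

lemma draws_estimator: "draws (estimator \<kappa> g m n h) \<omega> = n"
  by (simp add: draws_def estimator_def draws_run_sampler case_prod_beta)

lemma requests_estimator: "label_requests (estimator \<kappa> g m n h) \<omega> \<le> m"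
  using requests_run_sampler[of \<kappa> g m _ n 0 0 0 0]
  by (simp add: label_requests_def estimator_def case_prod_beta)

lemma answer_estimator:
  "answer (estimator \<kappa> g m n h) (s, u) =
     h (u 0) (snd (walk (\<kappa> \<circ> fst) (case_prod g) m n (0, 0) s (\<lambda>i. u (Suc i))))"
  by (simp add: answer_def estimator_def fst_run_sampler)

section \<open>Uniform coins\<close>

abbreviation coin :: "real measure" where
  "coin \<equiv> uniform_measure lborel {0..1}"

lemma prob_space_coin: "prob_space coin"
  by (rule prob_space_uniform_measure) auto

lemma emeasure_coin_interval:
  assumes "0 \<le> a" "a \<le> b" "b \<le> 1"
  shows "emeasure coin {a..b} = ennreal (b - a)"
  using assms by (subst emeasure_uniform_measure) (auto simp: divide_ennreal simp flip: ennreal_1)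

lemma emeasure_coin_atMost:
  assumes "k \<in> {0..1}"
  shows "emeasure coin {..k} = ennreal k"
proof -
  have "{0..1} \<inter> {..k} = {0..k}" using assms by auto
  then show ?thesis
    using assms by (subst emeasure_uniform_measure) (auto simp: divide_ennreal simp flip: ennreal_1)
qed

lemma emeasure_coin_greaterThan:
  assumes "k \<in> {0..1}"
  shows "emeasure coin {k<..} = ennreal (1 - k)"
proof -
  have "{0..1} \<inter> {k<..} = {k<..1}" using assms by auto
  then show ?thesis
    using assms by (subst emeasure_uniform_measure) (auto simp: divide_ennreal simp flip: ennreal_1)
qed

text \<open>The output is uniform on the interval from \<open>x - R\<close> to \<open>x + R\<close>.
  The window of radius \<tau> around \<open>t\<close> may stick out of it, but the half of the
  window on the side of \<open>x\<close> lies inside, because \<open>t\<close> is within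
  \<open>R\<close> of \<open>x\<close> and \<open>\<tau> \<le> R\<close>. That half has length
  \<tau> out of \<open>2 * R\<close>.\<close>

lemma emeasure_coin_window:
  assumes "\<bar>x - t\<bar> \<le> R" "0 < \<tau>" "\<tau> \<le> R"
  shows "emeasure coin {c. \<bar>x + R * (2 * c - 1) - t\<bar> \<le> \<tau>} \<ge> ennreal (\<tau> / (2 * R))"
proof -
  have R: "0 < R" using assms by linarith
  define w where "w = \<tau> / (2 * R)"
  \<comment> \<open>The coin value \<open>1 / 2 + (t - x) / (2 * R)\<close> produces exactly
    \<open>t\<close>. The interval of good coins starts there if \<open>t \<le> x\<close> and ends
    there otherwise.\<close>
  define a where "a = 1 / 2 + (t - x) / (2 * R) - (if t \<le> x then 0 else w)"
  have Rw: "2 * R * w = \<tau>" using R by (simp add: w_def)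
  have Ra: "2 * R * a = R + (t - x) - (if t \<le> x then 0 else \<tau>)"
    using R Rw unfolding a_def by (auto simp: field_simps)
  have w: "0 \<le> w" using R assms by (simp add: w_def)
  have "0 \<le> 2 * R * a" "2 * R * (a + w) \<le> 2 * R * 1"
    using assms Ra Rw by (auto simp: distrib_left split: if_splits)
  then have a: "0 \<le> a" "a + w \<le> 1"
    using R by (simp_all add: zero_le_mult_iff)
  have "ennreal w = emeasure coin {a..a + w}"
    using a w by (subst emeasure_coin_interval) auto
  also have "\<dots> \<le> emeasure coin {c. \<bar>x + R * (2 * c - 1) - t\<bar> \<le> \<tau>}"
  proof (rule emeasure_mono)
    show "{a..a + w} \<subseteq> {c. \<bar>x + R * (2 * c - 1) - t\<bar> \<le> \<tau>}"
    proof
      fix c assume "c \<in> {a..a + w}"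
      then have "2 * R * a \<le> 2 * R * c" "2 * R * c \<le> 2 * R * a + 2 * R * w"
        using R by (simp_all flip: distrib_left)
      then show "c \<in> {c. \<bar>x + R * (2 * c - 1) - t\<bar> \<le> \<tau>}"
        using Ra Rw by (auto simp: abs_le_iff algebra_simps split: if_splits)
    qed
  qed (simp, measurable)
  finally show ?thesis by (simp add: w_def)
qed

section \<open>Unrolling the product space\<close>

lemma nn_integral_PiM_nat:
  assumes "prob_space M"
    and F: "F \<in> borel_measurable (\<Pi>\<^sub>M i\<in>(UNIV :: nat set). M)"
  shows "(\<integral>\<^sup>+ s. F s \<partial>(\<Pi>\<^sub>M i\<in>UNIV. M)) =
    (\<integral>\<^sup>+ z. \<integral>\<^sup>+ s. F (case_nat z s) \<partial>(\<Pi>\<^sub>M i\<in>UNIV. M) \<partial>M)"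
proof -
  interpret sequence_space M
    using assms(1) by (simp add: sequence_space_def product_prob_space_def product_prob_space_axioms_def
      product_sigma_finite_def prob_space_imp_sigma_finite)
  note F[measurable]
  have m[measurable]: "(\<lambda>(z, s). case_nat z s) \<in> measurable (M \<Otimes>\<^sub>M S) S"
    by measurable
  have "(\<integral>\<^sup>+ s. F s \<partial>S) = (\<integral>\<^sup>+ s. F s \<partial>distr (M \<Otimes>\<^sub>M S) S (\<lambda>(z, s). case_nat z s))"
    by (simp add: PiM_iter)
  also have "\<dots> = (\<integral>\<^sup>+ p. F (case p of (z, s) \<Rightarrow> case_nat z s) \<partial>(M \<Otimes>\<^sub>M S))"
    by (rule nn_integral_distr) auto
  also have "\<dots> = (\<integral>\<^sup>+ z. \<integral>\<^sup>+ s. F (case_nat z s) \<partial>S \<partial>M)"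
    by (subst P.nn_integral_fst[symmetric]) auto
  finally show ?thesis .
qed

lemma nn_integral_sampling_space:
  assumes F: "F \<in> borel_measurable (sampling_space P)"
  shows "(\<integral>\<^sup>+ \<omega>. F \<omega> \<partial>sampling_space P) =
    (\<integral>\<^sup>+ s. \<integral>\<^sup>+ u. F (s, u) \<partial>(\<Pi>\<^sub>M i\<in>UNIV. coin) \<partial>(\<Pi>\<^sub>M i\<in>UNIV. P))"
proof -
  interpret U: prob_space "\<Pi>\<^sub>M i\<in>(UNIV :: nat set). coin"
    by (intro prob_space_PiM prob_space_coin)
  show ?thesis
    using F unfolding sampling_space_def by (rule U.nn_integral_fst[symmetric])
qed

text \<open>The new coin is integrated innermost, with the rest of the sample fixed: this is the
  form in which the output coin is independent of the walk.\<close>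

lemma nn_integral_first_coin:
  assumes F: "F \<in> borel_measurable (sampling_space P)"
  shows "(\<integral>\<^sup>+ \<omega>. F \<omega> \<partial>sampling_space P) =
    (\<integral>\<^sup>+ \<omega>. \<integral>\<^sup>+ c. F (fst \<omega>, case_nat c (snd \<omega>)) \<partial>coin \<partial>sampling_space P)"
proof -
  let ?U = "\<Pi>\<^sub>M i\<in>(UNIV :: nat set). coin" and ?S = "\<Pi>\<^sub>M i\<in>(UNIV :: nat set). P"
  interpret C: prob_space coin by (rule prob_space_coin)
  interpret U: prob_space ?U
    by (intro prob_space_PiM prob_space_coin)
  interpret CU: pair_sigma_finite coin ?U ..
  have F'[measurable]: "F \<in> borel_measurable (?S \<Otimes>\<^sub>M ?U)"
    using F unfolding sampling_space_def .
  have "(\<integral>\<^sup>+ u. F (s, u) \<partial>?U) = (\<integral>\<^sup>+ u. \<integral>\<^sup>+ c. F (s, case_nat c u) \<partial>coin \<partial>?U)" if s: "s \<in> space ?S" for s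
  proof -
    have [measurable]: "(\<lambda>u. F (s, u)) \<in> borel_measurable ?U"
      using s by measurable
    have "(\<integral>\<^sup>+ u. F (s, u) \<partial>?U) = (\<integral>\<^sup>+ c. \<integral>\<^sup>+ u. F (s, case_nat c u) \<partial>?U \<partial>coin)"
      by (rule nn_integral_PiM_nat[OF prob_space_coin]) measurable
    also have "\<dots> = (\<integral>\<^sup>+ u. \<integral>\<^sup>+ c. F (s, case_nat c u) \<partial>coin \<partial>?U)"
      using s by (intro CU.Fubini'[symmetric]) measurable
    finally show ?thesis .
  qed
  then have "(\<integral>\<^sup>+ \<omega>. F \<omega> \<partial>sampling_space P) = (\<integral>\<^sup>+ s. \<integral>\<^sup>+ u. \<integral>\<^sup>+ c. F (s, case_nat c u) \<partial>coin \<partial>?U \<partial>?S)"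
    by (subst nn_integral_sampling_space[OF F]) (rule nn_integral_cong, simp)
  also have "\<dots> = (\<integral>\<^sup>+ \<omega>. \<integral>\<^sup>+ c. F (fst \<omega>, case_nat c (snd \<omega>)) \<partial>coin \<partial>sampling_space P)"
    by (subst nn_integral_sampling_space) (simp_all add: sampling_space_def)
  finally show ?thesis .
qed

text \<open>Here the remaining sample is innermost, so that an induction hypothesis about walks from
  an arbitrary state applies after the first round.\<close>

lemma nn_integral_first_round:
  assumes P: "prob_space P" and F: "F \<in> borel_measurable (sampling_space P)"
  shows "(\<integral>\<^sup>+ \<omega>. F \<omega> \<partial>sampling_space P) =
    (\<integral>\<^sup>+ z. \<integral>\<^sup>+ c. \<integral>\<^sup>+ \<omega>. F (case_nat z (fst \<omega>), case_nat c (snd \<omega>)) \<partial>sampling_space P \<partial>coin \<partial>P)"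
proof -
  let ?U = "\<Pi>\<^sub>M i\<in>(UNIV :: nat set). coin" and ?S = "\<Pi>\<^sub>M i\<in>(UNIV :: nat set). P"
  interpret C: prob_space coin by (rule prob_space_coin)
  interpret U: prob_space ?U
    by (intro prob_space_PiM prob_space_coin)
  interpret Z: prob_space "sampling_space P" by (rule prob_space_sampling_space[OF P])
  interpret CZ: pair_sigma_finite coin "sampling_space P" ..
  have F'[measurable]: "F \<in> borel_measurable (?S \<Otimes>\<^sub>M ?U)"
    using F unfolding sampling_space_def .
  have "(\<integral>\<^sup>+ \<omega>. F \<omega> \<partial>sampling_space P) = (\<integral>\<^sup>+ z. \<integral>\<^sup>+ s. \<integral>\<^sup>+ u. F (case_nat z s, u) \<partial>?U \<partial>?S \<partial>P)"
    by (subst nn_integral_sampling_space[OF F]) (rule nn_integral_PiM_nat[OF P], measurable)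
  also have "\<dots> = (\<integral>\<^sup>+ z. \<integral>\<^sup>+ c. \<integral>\<^sup>+ \<omega>. F (case_nat z (fst \<omega>), case_nat c (snd \<omega>)) \<partial>sampling_space P \<partial>coin \<partial>P)"
  proof (intro nn_integral_cong)
    fix z assume z: "z \<in> space P"
    have Fz: "(\<lambda>\<omega>. F (case_nat z (fst \<omega>), snd \<omega>)) \<in> borel_measurable (sampling_space P)"
      using z unfolding sampling_space_def by measurable
    have "(\<integral>\<^sup>+ s. \<integral>\<^sup>+ u. F (case_nat z s, u) \<partial>?U \<partial>?S) = (\<integral>\<^sup>+ \<omega>. F (case_nat z (fst \<omega>), snd \<omega>) \<partial>sampling_space P)"
      by (subst nn_integral_sampling_space[OF Fz]) simp
    also have "\<dots> = (\<integral>\<^sup>+ \<omega>. \<integral>\<^sup>+ c. F (case_nat z (fst \<omega>), case_nat c (snd \<omega>)) \<partial>coin \<partial>sampling_space P)"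
      by (subst nn_integral_first_coin[OF Fz]) simp
    also have "\<dots> = (\<integral>\<^sup>+ c. \<integral>\<^sup>+ \<omega>. F (case_nat z (fst \<omega>), case_nat c (snd \<omega>)) \<partial>sampling_space P \<partial>coin)"
      by (intro CZ.Fubini') (use z in \<open>simp add: sampling_space_def; measurable\<close>)
    finally show "(\<integral>\<^sup>+ s. \<integral>\<^sup>+ u. F (case_nat z s, u) \<partial>?U \<partial>?S) =
      (\<integral>\<^sup>+ c. \<integral>\<^sup>+ \<omega>. F (case_nat z (fst \<omega>), case_nat c (snd \<omega>)) \<partial>sampling_space P \<partial>coin)" .
  qed
  finally show ?thesis .
qed

section \<open>Measurability of the walk\<close>

lemma measurable_step[measurable]:
  assumes [measurable]: "\<kappa> \<in> borel_measurable P" "g \<in> borel_measurable P"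
    "W \<in> measurable M (count_space UNIV \<Otimes>\<^sub>M borel)" "z \<in> measurable M P" "c \<in> borel_measurable M"
  shows "(\<lambda>\<omega>. step \<kappa> g m (W \<omega>) (z \<omega>) (c \<omega>)) \<in> measurable M (count_space UNIV \<Otimes>\<^sub>M borel)"
proof -
  have [measurable]: "Measurable.pred M (\<lambda>\<omega>. fst (W \<omega>) < m)"
    by measurable
  show ?thesis
    unfolding step_def case_prod_beta by measurable
qed

lemma measurable_sample[measurable]: "(\<lambda>\<omega>. fst \<omega> i) \<in> measurable (sampling_space P) P"
  unfolding sampling_space_def by measurable

lemma measurable_coin[measurable]: "(\<lambda>\<omega>. snd \<omega> i) \<in> borel_measurable (sampling_space P)"
proof -
  have "(\<lambda>\<omega>. snd \<omega> i) \<in> measurable (sampling_space P) coin"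
    unfolding sampling_space_def by measurable
  then show ?thesis by (simp add: measurable_def)
qed

text \<open>The offset is \<open>j = 0\<close> for the walk studied on its own and
  \<open>j = 1\<close> for the walk inside the estimator.\<close>

lemma measurable_walk:
  assumes [measurable]: "\<kappa> \<in> borel_measurable P" "g \<in> borel_measurable P"
  shows "(\<lambda>\<omega>. walk \<kappa> g m k st (fst \<omega>) (\<lambda>i. snd \<omega> (i + j)))
    \<in> measurable (sampling_space P) (count_space UNIV \<Otimes>\<^sub>M borel)"
  by (induction k) (auto simp: space_pair_measure)

section \<open>Concentration of the accepted samples\<close>

text \<open>Hoeffding's lemma under the probability density \<kappa> divided by its mean, multiplied
  back by that mean. The range of \<open>g\<close> has length 2, so the exponent
  \<open>l^2 * 2^2 / 8\<close> is \<open>l^2 / 2\<close>.\<close>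

lemma weighted_Hoeffdings_lemma:
  assumes P: "prob_space P"
    and [measurable]: "\<kappa> \<in> borel_measurable P" "g \<in> borel_measurable P"
    and \<kappa>: "\<And>z. z \<in> space P \<Longrightarrow> \<kappa> z \<in> {0..1}" and g: "\<And>z. z \<in> space P \<Longrightarrow> g z \<in> {-1..1}"
    and p: "0 < (\<integral>z. \<kappa> z \<partial>P)" and l: "0 < l"
    and \<mu>: "\<mu> = (\<integral>z. \<kappa> z * g z \<partial>P) / (\<integral>z. \<kappa> z \<partial>P)"
  shows "(\<integral>\<^sup>+ z. ennreal (\<kappa> z * exp (l * (g z - \<mu>))) \<partial>P) \<le> ennreal ((\<integral>z. \<kappa> z \<partial>P) * exp (l\<^sup>2 / 2))"
proof -
  interpret prob_space P by fact
  define p where "p = (\<integral>z. \<kappa> z \<partial>P)"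
  have p0: "0 < p" using p by (simp add: p_def)
  define Q where "Q = density P (\<lambda>z. ennreal (\<kappa> z / p))"
  have int: "integrable P \<kappa>"
    using \<kappa> by (intro integrable_const_bound[of _ 1]) auto
  have "(\<integral>\<^sup>+ z. ennreal (\<kappa> z / p) \<partial>P) = ennreal (\<integral>z. \<kappa> z / p \<partial>P)"
    using \<kappa> p0 int by (intro nn_integral_eq_integral) (auto intro!: AE_I2 divide_nonneg_pos)
  then have "(\<integral>\<^sup>+ z. ennreal (\<kappa> z / p) \<partial>P) = 1"
    using p0 by (simp flip: p_def)
  then interpret Q: prob_space Q
    unfolding Q_def by (intro prob_spaceI) (simp add: emeasure_density cong: nn_integral_cong)
  interpret Q: interval_bounded_random_variable Q g "-1" 1
    by unfold_locales (use g in \<open>auto simp: Q_def intro!: AE_I2\<close>)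
  have E: "Q.expectation g = \<mu>"
    unfolding Q_def using p0 \<kappa>
    by (subst integral_density) (auto intro!: AE_I2 simp: \<mu> p_def[symmetric] divide_nonneg_pos)
  have "(\<integral>\<^sup>+ z. ennreal (\<kappa> z * exp (l * (g z - \<mu>))) \<partial>P)
      = (\<integral>\<^sup>+ z. ennreal p * (ennreal (\<kappa> z / p) * ennreal (exp (l * (g z - \<mu>)))) \<partial>P)"
    using p0 \<kappa> by (intro nn_integral_cong) (auto simp flip: ennreal_mult)
  also have "\<dots> = ennreal p * (\<integral>\<^sup>+ z. ennreal (\<kappa> z / p) * ennreal (exp (l * (g z - \<mu>))) \<partial>P)"
    by (rule nn_integral_cmult) measurable
  also have "(\<integral>\<^sup>+ z. ennreal (\<kappa> z / p) * ennreal (exp (l * (g z - \<mu>))) \<partial>P)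
      = (\<integral>\<^sup>+ z. ennreal (exp (l * (g z - \<mu>))) \<partial>Q)"
    unfolding Q_def by (rule nn_integral_density[symmetric]) measurable
  also have "\<dots> \<le> ennreal (exp (l\<^sup>2 / 2))"
    using Q.Hoeffdings_lemma_nn_integral[OF l] by (simp add: E)
  also have "ennreal p * ennreal (exp (l\<^sup>2 / 2)) = ennreal (p * exp (l\<^sup>2 / 2))"
    using p0 by (simp add: ennreal_mult)
  finally show ?thesis by (simp add: p_def mult_left_mono)
qed

locale rejection_sampling = prob_space P
  for P :: "('x \<times> real) measure" +
  fixes \<kappa> g :: "'x \<times> real \<Rightarrow> real" and m :: nat
  assumes measurable_filter[measurable]: "\<kappa> \<in> borel_measurable P"
    and measurable_query[measurable]: "g \<in> borel_measurable P"
    and filter_bounds: "z \<in> space P \<Longrightarrow> \<kappa> z \<in> {0..1}"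
    and query_bounds: "z \<in> space P \<Longrightarrow> g z \<in> {-1..1}"
begin

abbreviation "\<Omega> \<equiv> sampling_space P"
definition "p = (\<integral>z. \<kappa> z \<partial>P)"
definition "\<mu> = (\<integral>z. \<kappa> z * g z \<partial>P) / p"

sublocale \<Omega>: prob_space \<Omega>
  by (rule prob_space_sampling_space) (rule prob_space_axioms)

lemma integrable_filter: "integrable P \<kappa>"
  using filter_bounds by (intro integrable_const_bound[of _ 1]) auto

lemma acceptance_bounds: "0 \<le> p" "p \<le> 1"
proof -
  show "0 \<le> p"
    unfolding p_def using filter_bounds by (intro integral_nonneg_AE) auto
  have "p \<le> (\<integral>z. 1 \<partial>P)"
    unfolding p_def using filter_bounds integrable_filter by (intro integral_mono) auto
  then show "p \<le> 1" by (simp add: prob_space)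
qed

lemma nn_integral_rejection: "(\<integral>\<^sup>+ z. ennreal (1 - \<kappa> z) \<partial>P) = ennreal (1 - p)"
proof -
  have "(\<integral>\<^sup>+ z. ennreal (1 - \<kappa> z) \<partial>P) = ennreal (\<integral>z. 1 - \<kappa> z \<partial>P)"
    using filter_bounds integrable_filter by (intro nn_integral_eq_integral) auto
  then show ?thesis
    using integrable_filter by (simp add: p_def prob_space)
qed

lemma nn_integral_coin_step:
  assumes "N < m" "z \<in> space P"
  shows "(\<integral>\<^sup>+ c. V (step \<kappa> g m (N, T) z c) \<partial>coin) =
    ennreal (\<kappa> z) * V (Suc N, T + g z) + ennreal (1 - \<kappa> z) * V (N, T)"
proof -
  have "(\<integral>\<^sup>+ c. V (step \<kappa> g m (N, T) z c) \<partial>coin) =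
    (\<integral>\<^sup>+ c. V (Suc N, T + g z) * indicator {..\<kappa> z} c + V (N, T) * indicator {\<kappa> z<..} c \<partial>coin)"
    using assms by (intro nn_integral_cong) (auto simp: step_def indicator_def)
  also have "\<dots> = V (Suc N, T + g z) * emeasure coin {..\<kappa> z} + V (N, T) * emeasure coin {\<kappa> z<..}"
    by (subst nn_integral_add) (auto simp: nn_integral_cmult_indicator)
  finally show ?thesis
    using filter_bounds[OF assms(2)]
    by (simp only: emeasure_coin_atMost emeasure_coin_greaterThan mult.commute)
qed

lemma nn_integral_step_le:
  assumes w[measurable]: "w \<in> borel_measurable P" and w0: "\<And>z. 0 \<le> w z"
    and grow: "\<And>N T z. z \<in> space P \<Longrightarrow> N < m \<Longrightarrow> V (Suc N, T + g z) \<le> ennreal (w z) * V (N, T)"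
    and mean: "(\<integral>\<^sup>+ z. ennreal (\<kappa> z * w z) \<partial>P) + ennreal (1 - p) \<le> \<theta>"
    and stop: "\<And>N T. m \<le> N \<Longrightarrow> V (N, T) \<le> \<theta> * V (N, T)"
  shows "(\<integral>\<^sup>+ z. \<integral>\<^sup>+ c. V (step \<kappa> g m st z c) \<partial>coin \<partial>P) \<le> \<theta> * V st"
proof (cases st)
  case st: (Pair N T)
  interpret C: prob_space coin by (rule prob_space_coin)
  show ?thesis
  proof (cases "N < m")
    case False
    then show ?thesis
      using stop[of N T] by (simp add: st step_def C.emeasure_space_1 emeasure_space_1)
  next
    case True
    have "(\<integral>\<^sup>+ z. \<integral>\<^sup>+ c. V (step \<kappa> g m st z c) \<partial>coin \<partial>P)
        \<le> (\<integral>\<^sup>+ z. V st * (ennreal (\<kappa> z * w z) + ennreal (1 - \<kappa> z)) \<partial>P)"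
    proof (intro nn_integral_mono)
      fix z assume z: "z \<in> space P"
      have "(\<integral>\<^sup>+ c. V (step \<kappa> g m st z c) \<partial>coin)
          \<le> ennreal (\<kappa> z) * (ennreal (w z) * V (N, T)) + ennreal (1 - \<kappa> z) * V (N, T)"
        using grow[OF z True, of T] by (simp add: st nn_integral_coin_step[OF True z] add_right_mono mult_left_mono)
      also have "\<dots> = V st * (ennreal (\<kappa> z * w z) + ennreal (1 - \<kappa> z))"
        using filter_bounds[OF z] w0[of z] by (simp add: st ennreal_mult algebra_simps)
      finally show "(\<integral>\<^sup>+ c. V (step \<kappa> g m st z c) \<partial>coin) \<le> V st * (ennreal (\<kappa> z * w z) + ennreal (1 - \<kappa> z))" .
    qed
    also have "\<dots> = V st * ((\<integral>\<^sup>+ z. ennreal (\<kappa> z * w z) \<partial>P) + ennreal (1 - p))"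
      by (simp add: nn_integral_cmult nn_integral_add nn_integral_rejection)
    also have "\<dots> \<le> V st * \<theta>"
      by (intro mult_left_mono mean) simp
    finally show ?thesis by (simp add: mult.commute)
  qed
qed

text \<open>After the first round the rest of the sample has its original distribution, and the walk
  restarts from the state reached. Hence the induction is over all starting states.\<close>

lemma nn_integral_walk_le:
  assumes V[measurable]: "V \<in> borel_measurable (count_space UNIV \<Otimes>\<^sub>M borel)"
    and step: "\<And>st. (\<integral>\<^sup>+ z. \<integral>\<^sup>+ c. V (step \<kappa> g m st z c) \<partial>coin \<partial>P) \<le> \<theta> * V st"
  shows "(\<integral>\<^sup>+ \<omega>. V (walk \<kappa> g m k st (fst \<omega>) (snd \<omega>)) \<partial>\<Omega>) \<le> \<theta> ^ k * V st"
proof (induction k arbitrary: st)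
  case 0
  show ?case by (simp add: \<Omega>.emeasure_space_1)
next
  case (Suc k)
  interpret C: prob_space coin by (rule prob_space_coin)
  have [measurable]: "(\<lambda>\<omega>. walk \<kappa> g m j st (fst \<omega>) (snd \<omega>)) \<in> measurable \<Omega> (count_space UNIV \<Otimes>\<^sub>M borel)" for j st
    using measurable_walk[of \<kappa> P g m j st 0] by simp
  have [measurable]: "(\<lambda>x. step \<kappa> g m st (fst x) (snd x)) \<in> measurable (P \<Otimes>\<^sub>M coin) (count_space UNIV \<Otimes>\<^sub>M borel)"
    by (rule measurable_step) (auto simp: space_pair_measure)
  have "(\<integral>\<^sup>+ \<omega>. V (walk \<kappa> g m (Suc k) st (fst \<omega>) (snd \<omega>)) \<partial>\<Omega>) =
    (\<integral>\<^sup>+ z. \<integral>\<^sup>+ c. \<integral>\<^sup>+ \<omega>. V (walk \<kappa> g m k (step \<kappa> g m st z c) (fst \<omega>) (snd \<omega>)) \<partial>\<Omega> \<partial>coin \<partial>P)"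
    by (subst nn_integral_first_round[OF prob_space_axioms])
      (measurable, simp add: walk_Suc_front del: walk.simps)
  also have "\<dots> \<le> (\<integral>\<^sup>+ z. \<integral>\<^sup>+ c. \<theta> ^ k * V (step \<kappa> g m st z c) \<partial>coin \<partial>P)"
    by (intro nn_integral_mono Suc.IH)
  also have "\<dots> = (\<integral>\<^sup>+ z. \<theta> ^ k * (\<integral>\<^sup>+ c. V (step \<kappa> g m st z c) \<partial>coin) \<partial>P)"
    by (intro nn_integral_cong nn_integral_cmult) (rule measurable_compose[OF _ V], rule measurable_step[where P = P], auto simp: space_pair_measure)
  also have "\<dots> = \<theta> ^ k * (\<integral>\<^sup>+ z. \<integral>\<^sup>+ c. V (step \<kappa> g m st z c) \<partial>coin \<partial>P)"
    by (intro nn_integral_cmult C.borel_measurable_nn_integral) (simp add: case_prod_beta)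
  also have "\<dots> \<le> \<theta> ^ k * (\<theta> * V st)"
    by (intro mult_left_mono step) simp
  finally show ?case by (simp add: mult_ac)
qed

lemma fst_walk_le: "N \<le> m \<Longrightarrow> fst (walk \<kappa> g m k (N, T) s u) \<le> m"
  by (induction k) (auto simp: step_def case_prod_beta)

text \<open>Each acceptance divides \<open>V\<close> by \<open>e\<close>, hence by at least 2, so a
  draw multiplies its mean by at most \<open>(1 - p) + p / 2\<close>. The start value is at most
  \<open>exp m\<close>, and \<open>V\<close> is at least 1 while fewer than \<open>m\<close> points
  are accepted.\<close>

lemma few_accepted:
  "emeasure \<Omega> {\<omega> \<in> space \<Omega>. fst (walk \<kappa> g m n (0, 0) (fst \<omega>) (snd \<omega>)) < m} \<le> ennreal (exp (real m - real n * p / 2))"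
proof -
  \<comment> \<open>The value 0 from \<open>m\<close> accepted points on is essential: a frozen
    state keeps its value, while the factor \<open>1 - p / 2\<close> may be below 1.\<close>
  define V :: "nat \<times> real \<Rightarrow> ennreal" where
    "V = (\<lambda>st. if fst st < m then ennreal (exp (real m - real (fst st))) else 0)"
  let ?W = "\<lambda>\<omega>. walk \<kappa> g m n (0, 0) (fst \<omega>) (snd \<omega>)"
  have [measurable]: "V \<in> borel_measurable (count_space UNIV \<Otimes>\<^sub>M borel)"
    unfolding V_def by measurable
  have W[measurable]: "?W \<in> measurable \<Omega> (count_space UNIV \<Otimes>\<^sub>M borel)"
    using measurable_walk[of \<kappa> P g m n "(0, 0)" 0] by simp
  have e: "exp (-1) \<le> (1/2 :: real)"
    using exp_ge_add_one_self[of 1] by (simp add: exp_minus field_simps)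
  have "(\<integral>\<^sup>+ z. ennreal (\<kappa> z * (1/2)) \<partial>P) = ennreal (\<integral>z. \<kappa> z * (1/2) \<partial>P)"
    using filter_bounds integrable_filter by (intro nn_integral_eq_integral) auto
  then have "(\<integral>\<^sup>+ z. ennreal (\<kappa> z * (1/2)) \<partial>P) + ennreal (1 - p) = ennreal (1 - p / 2)"
    using acceptance_bounds by (simp flip: p_def ennreal_plus)
  then have "(\<integral>\<^sup>+ z. \<integral>\<^sup>+ c. V (step \<kappa> g m st z c) \<partial>coin \<partial>P) \<le> ennreal (1 - p / 2) * V st" for st
  proof (intro nn_integral_step_le[where w = "\<lambda>_. 1/2"])
    fix N z and T :: real assume "N < m"
    have "exp (real m - real (Suc N)) = exp (-1) * exp (real m - real N)"
      by (simp flip: exp_add add: algebra_simps)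
    also have "\<dots> \<le> (1/2) * exp (real m - real N)"
      using e by (intro mult_right_mono) auto
    finally have "ennreal (exp (real m - real (Suc N))) \<le> ennreal (1/2) * ennreal (exp (real m - real N))"
      by (subst ennreal_mult[symmetric]) (auto intro: ennreal_leI)
    then show "V (Suc N, T + g z) \<le> ennreal (1/2) * V (N, T)"
      using \<open>N < m\<close> by (simp add: V_def del: of_nat_Suc)
  qed (auto simp: V_def)
  from nn_integral_walk_le[OF _ this, of n "(0, 0)"]
  have *: "(\<integral>\<^sup>+ \<omega>. V (?W \<omega>) \<partial>\<Omega>) \<le> ennreal (1 - p / 2) ^ n * V (0, 0)" by simp
  have "emeasure \<Omega> {\<omega> \<in> space \<Omega>. fst (?W \<omega>) < m} = (\<integral>\<^sup>+ \<omega>. indicator {\<omega> \<in> space \<Omega>. fst (?W \<omega>) < m} \<omega> \<partial>\<Omega>)"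
    by (intro nn_integral_indicator[symmetric]) measurable
  also have "\<dots> \<le> (\<integral>\<^sup>+ \<omega>. V (?W \<omega>) \<partial>\<Omega>)"
    by (intro nn_integral_mono) (auto simp: V_def indicator_def one_le_exp_iff simp flip: ennreal_1 intro!: ennreal_leI)
  also note *
  also have "ennreal (1 - p / 2) ^ n * V (0, 0) \<le> ennreal (exp (- p / 2)) ^ n * ennreal (exp (real m))"
    using exp_ge_add_one_self[of "- p / 2"]
    by (intro mult_mono power_mono ennreal_leI) (auto simp: V_def)
  also have "\<dots> = ennreal (exp (real m - real n * p / 2))"
    by (simp add: ennreal_power flip: ennreal_mult exp_of_nat_mult exp_add)
  finally show ?thesis .
qed

text \<open>Each accepted point contributes a compensated exponential with mean at most 1, so
  \<theta> is 1. The tilting parameter \<rho> is the optimal one: on the event \<open>V\<close> is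
  at least \<open>exp (m * \<rho>^2 - m * \<rho>^2 / 2)\<close>, and Markov's inequality gives the
  bound. The sign \<sigma> yields both tails.\<close>

lemma large_deviation:
  fixes \<rho> \<sigma> :: real
  assumes p: "0 < p" and \<rho>: "0 < \<rho>" and \<sigma>: "\<sigma> \<in> {-1, 1}"
  shows "emeasure \<Omega> {\<omega> \<in> space \<Omega>. fst (walk \<kappa> g m n (0, 0) (fst \<omega>) (snd \<omega>)) = m \<and>
      \<sigma> * (snd (walk \<kappa> g m n (0, 0) (fst \<omega>) (snd \<omega>)) - m * \<mu>) \<ge> m * \<rho>} \<le> ennreal (exp (- (m * \<rho>\<^sup>2 / 2)))"
    (is "emeasure \<Omega> ?E \<le> _")
proof -
  define V :: "nat \<times> real \<Rightarrow> ennreal" where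
    "V = (\<lambda>st. ennreal (exp (\<rho> * (\<sigma> * (snd st - real (fst st) * \<mu>)) - real (fst st) * \<rho>\<^sup>2 / 2)))"
  let ?W = "\<lambda>\<omega>. walk \<kappa> g m n (0, 0) (fst \<omega>) (snd \<omega>)"
  have [measurable]: "V \<in> borel_measurable (count_space UNIV \<Otimes>\<^sub>M borel)"
    unfolding V_def by measurable
  have W[measurable]: "?W \<in> measurable \<Omega> (count_space UNIV \<Otimes>\<^sub>M borel)"
    using measurable_walk[of \<kappa> P g m n "(0, 0)" 0] by simp
  have H: "(\<integral>\<^sup>+ z. ennreal (\<kappa> z * exp (\<rho> * (\<sigma> * g z - \<sigma> * \<mu>))) \<partial>P) \<le> ennreal (p * exp (\<rho>\<^sup>2 / 2))"
    unfolding p_def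
  proof (intro weighted_Hoeffdings_lemma prob_space_axioms filter_bounds \<rho>)
    show "\<sigma> * \<mu> = (\<integral>z. \<kappa> z * (\<sigma> * g z) \<partial>P) / (\<integral>z. \<kappa> z \<partial>P)"
      using \<sigma> by (auto simp: \<mu>_def p_def)
    show "\<sigma> * g z \<in> {-1..1}" if "z \<in> space P" for z
      using query_bounds[OF that] \<sigma> by auto
  qed (use p in \<open>auto simp: p_def\<close>)
  have "(\<integral>\<^sup>+ z. ennreal (\<kappa> z * (exp (\<rho> * (\<sigma> * g z - \<sigma> * \<mu>)) * exp (- (\<rho>\<^sup>2 / 2)))) \<partial>P)
      = (\<integral>\<^sup>+ z. ennreal (\<kappa> z * exp (\<rho> * (\<sigma> * g z - \<sigma> * \<mu>))) * ennreal (exp (- (\<rho>\<^sup>2 / 2))) \<partial>P)"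
    using filter_bounds by (intro nn_integral_cong) (auto simp: mult_ac simp flip: ennreal_mult)
  also have "\<dots> = (\<integral>\<^sup>+ z. ennreal (\<kappa> z * exp (\<rho> * (\<sigma> * g z - \<sigma> * \<mu>))) \<partial>P) * ennreal (exp (- (\<rho>\<^sup>2 / 2)))"
    by (rule nn_integral_multc) measurable
  also have "\<dots> \<le> ennreal (p * exp (\<rho>\<^sup>2 / 2)) * ennreal (exp (- (\<rho>\<^sup>2 / 2)))"
    by (intro mult_right_mono H) simp
  also have "\<dots> = ennreal p"
    using p by (simp add: exp_minus flip: ennreal_mult)
  finally have "(\<integral>\<^sup>+ z. ennreal (\<kappa> z * (exp (\<rho> * (\<sigma> * g z - \<sigma> * \<mu>)) * exp (- (\<rho>\<^sup>2 / 2)))) \<partial>P) + ennreal (1 - p)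
      \<le> ennreal p + ennreal (1 - p)"
    by (intro add_right_mono)
  also have "\<dots> = 1"
    using acceptance_bounds by (simp flip: ennreal_plus)
  finally have "(\<integral>\<^sup>+ z. \<integral>\<^sup>+ c. V (step \<kappa> g m st z c) \<partial>coin \<partial>P) \<le> 1 * V st" for st
    by (intro nn_integral_step_le[where w = "\<lambda>z. exp (\<rho> * (\<sigma> * g z - \<sigma> * \<mu>)) * exp (- (\<rho>\<^sup>2 / 2))"])
      (auto simp: V_def field_simps simp flip: ennreal_mult exp_add)
  from nn_integral_walk_le[OF _ this, of n "(0, 0)"]
  have *: "(\<integral>\<^sup>+ \<omega>. V (?W \<omega>) \<partial>\<Omega>) \<le> 1" by (simp add: V_def)
  have "emeasure \<Omega> ?E = (\<integral>\<^sup>+ \<omega>. indicator ?E \<omega> \<partial>\<Omega>)"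
    by (intro nn_integral_indicator[symmetric]) measurable
  also have "\<dots> \<le> (\<integral>\<^sup>+ \<omega>. ennreal (exp (- (m * \<rho>\<^sup>2 / 2))) * V (?W \<omega>) \<partial>\<Omega>)"
  proof (intro nn_integral_mono)
    fix \<omega>
    show "indicator ?E \<omega> \<le> ennreal (exp (- (m * \<rho>\<^sup>2 / 2))) * V (?W \<omega>)"
    proof (cases "\<omega> \<in> ?E")
      case True
      then have "\<rho> * (m * \<rho>) \<le> \<rho> * (\<sigma> * (snd (?W \<omega>) - m * \<mu>))"
        using \<rho> by (intro mult_left_mono) auto
      then have "0 \<le> - (m * \<rho>\<^sup>2 / 2) + (\<rho> * (\<sigma> * (snd (?W \<omega>) - m * \<mu>)) - m * \<rho>\<^sup>2 / 2)"
        by (simp add: power2_eq_square mult_ac)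
      then show ?thesis
        using True by (auto simp: V_def simp flip: ennreal_mult exp_add ennreal_1 intro!: ennreal_leI)
    qed simp
  qed
  also have "\<dots> = ennreal (exp (- (m * \<rho>\<^sup>2 / 2))) * (\<integral>\<^sup>+ \<omega>. V (?W \<omega>) \<partial>\<Omega>)"
    by (rule nn_integral_cmult) measurable
  also have "\<dots> \<le> ennreal (exp (- (m * \<rho>\<^sup>2 / 2))) * 1"
    by (intro mult_left_mono *) simp
  finally show ?thesis by simp
qed

text \<open>Union bound over three events of equal bound: too few acceptances and the two tails of
  the sum.\<close>

lemma concentration:
  fixes \<rho> :: real
  assumes p: "0 < p" and \<rho>: "0 < \<rho>" "\<rho> \<le> 1" and n: "4 * real m \<le> real n * p"
  shows "\<Omega>.prob {\<omega> \<in> space \<Omega>. \<bar>snd (walk \<kappa> g m n (0, 0) (fst \<omega>) (snd \<omega>)) - m * \<mu>\<bar> \<le> m * \<rho>}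
    \<ge> 1 - 3 * exp (- (m * \<rho>\<^sup>2 / 2))"
proof -
  let ?W = "\<lambda>\<omega>. walk \<kappa> g m n (0, 0) (fst \<omega>) (snd \<omega>)"
  have W[measurable]: "?W \<in> measurable \<Omega> (count_space UNIV \<Otimes>\<^sub>M borel)"
    using measurable_walk[of \<kappa> P g m n "(0, 0)" 0] by simp
  define q where "q = exp (- (m * \<rho>\<^sup>2 / 2))"
  let ?G = "{\<omega> \<in> space \<Omega>. \<bar>snd (?W \<omega>) - m * \<mu>\<bar> \<le> m * \<rho>}"
  let ?F = "{\<omega> \<in> space \<Omega>. fst (?W \<omega>) < m}"
  let ?D = "\<lambda>\<sigma>. {\<omega> \<in> space \<Omega>. fst (?W \<omega>) = m \<and> \<sigma> * (snd (?W \<omega>) - m * \<mu>) \<ge> m * \<rho>}"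
  have G: "?G \<in> sets \<Omega>" by measurable
  have F: "?F \<in> sets \<Omega>" by measurable
  have D: "?D \<sigma> \<in> sets \<Omega>" for \<sigma> by measurable
  have "\<rho>\<^sup>2 \<le> 1"
    using \<rho> by (simp add: power_le_one)
  then have "m * \<rho>\<^sup>2 \<le> m" by (simp add: mult_left_le)
  \<comment> \<open>Since \<open>n * p / 2\<close> is at least \<open>2 * m\<close>, the exponent is
    at most \<open>- m\<close>, and \<open>\<rho> \<le> 1\<close> puts this below
    \<open>- (m * \<rho>^2 / 2)\<close>.\<close>
  then have "exp (real m - real n * p / 2) \<le> q"
    using n by (simp add: q_def)
  then have "emeasure \<Omega> ?F \<le> ennreal q"
    using few_accepted[of n] by (meson ennreal_leI order_trans)
  then have 1: "\<Omega>.prob ?F \<le> q"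
    by (simp add: \<Omega>.emeasure_eq_measure q_def)
  have 2: "\<Omega>.prob (?D \<sigma>) \<le> q" if "\<sigma> \<in> {-1, 1}" for \<sigma>
    using large_deviation[OF p \<rho>(1) that, of n] by (simp add: \<Omega>.emeasure_eq_measure q_def)
  have "space \<Omega> - ?G \<subseteq> ?F \<union> (?D 1 \<union> ?D (-1))"
  proof
    fix \<omega> assume "\<omega> \<in> space \<Omega> - ?G"
    then show "\<omega> \<in> ?F \<union> (?D 1 \<union> ?D (-1))"
      \<comment> \<open>The count never exceeds \<open>m\<close>, so outside the first event it
        equals \<open>m\<close>, as the tail events require.\<close>
      using fst_walk_le[of 0 n 0 "fst \<omega>" "snd \<omega>"] by (auto simp: abs_le_iff)
  qed
  then have "\<Omega>.prob (space \<Omega> - ?G) \<le> \<Omega>.prob (?F \<union> (?D 1 \<union> ?D (-1)))"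
    using F D by (intro \<Omega>.finite_measure_mono) auto
  also have "\<dots> \<le> \<Omega>.prob ?F + (\<Omega>.prob (?D 1) + \<Omega>.prob (?D (-1)))"
    using F D by (intro order_trans[OF measure_Un_le] add_left_mono
      measure_Un_le sets.Un) auto
  also have "\<dots> \<le> 3 * q"
    using 1 2[of 1] 2[of "-1"] by simp
  finally show ?thesis
    using \<Omega>.prob_compl[OF G] by (simp add: q_def)
qed

text \<open>The walk uses the coins from number 1 on, so prepending a fresh coin \<open>b\<close> to
  \<omega> changes only the first argument of \<open>h\<close>. For each \<omega> whose walk ends in
  \<open>B\<close>, the fresh coin then hits \<open>X\<close> with probability at least
  \<open>q\<close>.\<close>

lemma prob_randomized_output:
  assumes [measurable]: "case_prod h \<in> borel_measurable (borel \<Otimes>\<^sub>M borel)" "X \<in> sets borel" "B \<in> sets borel"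
    and q: "0 \<le> q" and hit: "\<And>T. T \<in> B \<Longrightarrow> emeasure coin {b. h b T \<in> X} \<ge> ennreal q"
  shows "\<Omega>.prob {\<omega> \<in> space \<Omega>. h (snd \<omega> 0) (snd (walk \<kappa> g m n (0, 0) (fst \<omega>) (\<lambda>i. snd \<omega> (Suc i)))) \<in> X}
    \<ge> q * \<Omega>.prob {\<omega> \<in> space \<Omega>. snd (walk \<kappa> g m n (0, 0) (fst \<omega>) (snd \<omega>)) \<in> B}"
    (is "\<Omega>.prob ?E \<ge> q * \<Omega>.prob ?G")
proof -
  have W[measurable]: "(\<lambda>\<omega>. walk \<kappa> g m n (0, 0) (fst \<omega>) (snd \<omega>)) \<in> measurable \<Omega> (count_space UNIV \<Otimes>\<^sub>M borel)"
    using measurable_walk[of \<kappa> P g m n "(0, 0)" 0] by simp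
  have W'[measurable]: "(\<lambda>\<omega>. walk \<kappa> g m n (0, 0) (fst \<omega>) (\<lambda>i. snd \<omega> (Suc i))) \<in> measurable \<Omega> (count_space UNIV \<Otimes>\<^sub>M borel)"
    using measurable_walk[of \<kappa> P g m n "(0, 0)" 1] by simp
  have out: "(\<lambda>\<omega>. h (snd \<omega> 0) (snd (walk \<kappa> g m n (0, 0) (fst \<omega>) (\<lambda>i. snd \<omega> (Suc i))))) \<in> borel_measurable \<Omega>"
    using measurable_compose[of "\<lambda>\<omega>. (snd \<omega> 0, snd (walk \<kappa> g m n (0, 0) (fst \<omega>) (\<lambda>i. snd \<omega> (Suc i))))" \<Omega> "borel \<Otimes>\<^sub>M borel" "case_prod h" borel]
    by simp
  have E[measurable]: "?E \<in> sets \<Omega>"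
    using out by measurable
  have G[measurable]: "?G \<in> sets \<Omega>" by measurable
  have hX: "{b. h b T \<in> X} \<in> sets coin" for T
  proof -
    have "(\<lambda>b. h b T) \<in> borel_measurable borel"
      using measurable_compose[of "\<lambda>b. (b, T)" borel "borel \<Otimes>\<^sub>M borel" "case_prod h" borel] by simp
    then have "{b \<in> space borel. h b T \<in> X} \<in> sets borel" by measurable
    then show ?thesis by simp
  qed
  have "ennreal (q * \<Omega>.prob ?G) = (\<integral>\<^sup>+ \<omega>. ennreal q * indicator ?G \<omega> \<partial>\<Omega>)"
    using q by (simp add: nn_integral_cmult_indicator \<Omega>.emeasure_eq_measure ennreal_mult)
  also have "\<dots> \<le> (\<integral>\<^sup>+ \<omega>. \<integral>\<^sup>+ b. indicator ?E (fst \<omega>, case_nat b (snd \<omega>)) \<partial>coin \<partial>\<Omega>)"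
  proof (intro nn_integral_mono)
    fix \<omega> assume \<omega>: "\<omega> \<in> space \<Omega>"
    let ?T = "snd (walk \<kappa> g m n (0, 0) (fst \<omega>) (snd \<omega>))"
    have sp: "(fst \<omega>, case_nat b (snd \<omega>)) \<in> space \<Omega>" for b
      using \<omega> by (auto simp: sampling_space_def space_pair_measure space_PiM split: nat.split)
    have "(\<integral>\<^sup>+ b. indicator ?E (fst \<omega>, case_nat b (snd \<omega>)) \<partial>coin) = (\<integral>\<^sup>+ b. indicator {b. h b ?T \<in> X} b \<partial>coin)"
      using sp by (intro nn_integral_cong) (simp add: indicator_def)
    also have "\<dots> = emeasure coin {b. h b ?T \<in> X}"
      by (rule nn_integral_indicator[OF hX])
    finally show "ennreal q * indicator ?G \<omega> \<le> (\<integral>\<^sup>+ b. indicator ?E (fst \<omega>, case_nat b (snd \<omega>)) \<partial>coin)"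
      using hit[of ?T] by (auto simp: indicator_def simp del: emeasure_uniform_measure)
  qed
  also have "\<dots> = (\<integral>\<^sup>+ \<omega>. indicator ?E \<omega> \<partial>\<Omega>)"
    by (rule nn_integral_first_coin[symmetric]) measurable
  also have "\<dots> = ennreal (\<Omega>.prob ?E)"
    by (simp add: \<Omega>.emeasure_eq_measure)
  finally show ?thesis
    by (subst (asm) ennreal_le_iff) auto
qed

end

section \<open>Integrals against a labeled distribution\<close>

lemma integral_labeled_dist:
  fixes f :: "'x \<times> real \<Rightarrow> real"
  assumes D: "prob_space D" and psi[measurable]: "\<psi> \<in> borel_measurable D"
    and bnd: "\<And>x. x \<in> space D \<Longrightarrow> \<psi> x \<in> {-1..1}"
    and f[measurable]: "f \<in> borel_measurable (D \<Otimes>\<^sub>M count_space {-1, 1})"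
    and f1: "\<And>x l. x \<in> space D \<Longrightarrow> l \<in> {-1, 1} \<Longrightarrow> \<bar>f (x, l)\<bar> \<le> 1"
  shows "(\<integral>z. f z \<partial>labeled_dist D \<psi>) =
    (\<integral>x. (1 + \<psi> x) / 2 * f (x, 1) + (1 - \<psi> x) / 2 * f (x, -1) \<partial>D)"
proof -
  interpret D: prob_space D by fact
  interpret L: prob_space "labeled_dist D \<psi>"
    by (rule prob_space_labeled_dist[OF D psi bnd])
  let ?h = "\<lambda>x. (1 + \<psi> x) / 2 * f (x, 1) + (1 - \<psi> x) / 2 * f (x, -1)"
  have m: "f \<in> borel_measurable (labeled_dist D \<psi>)"
    by (simp add: measurable_cong_sets[OF sets_labeled_dist refl])
  have intf: "integrable (labeled_dist D \<psi>) f"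
    using f1 by (intro L.integrable_const_bound[where B = 1, OF _ m] AE_I2) auto
  have mf: "(\<lambda>x. f (x, l)) \<in> borel_measurable D" if "l \<in> {-1, 1}" for l
    using that by (intro measurable_compose[OF _ f] measurable_Pair) auto
  have mh[measurable]: "?h \<in> borel_measurable D"
    using mf[of 1] mf[of "-1"] by measurable
  have h1: "\<bar>?h x\<bar> \<le> 1" if x: "x \<in> space D" for x
  proof -
    have "\<bar>?h x\<bar> \<le> (1 + \<psi> x) / 2 * \<bar>f (x, 1)\<bar> + (1 - \<psi> x) / 2 * \<bar>f (x, -1)\<bar>"
      using bnd[OF x] by (intro order_trans[OF abs_triangle_ineq]) (simp add: abs_mult)
    also have "\<dots> \<le> (1 + \<psi> x) / 2 * 1 + (1 - \<psi> x) / 2 * 1"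
      using bnd[OF x] f1[OF x] by (intro add_mono mult_left_mono) auto
    finally show ?thesis by (simp add: field_simps)
  qed
  have inth: "integrable D ?h"
    using h1 by (intro D.integrable_const_bound[where B = 1, OF _ mh] AE_I2) auto
  \<comment> \<open>Adding 1 makes \<open>f\<close> nonnegative, so the formula for nonnegative
    integrals applies; the shift cancels because both measures have total mass 1.\<close>
  have "ennreal (\<integral>z. f z + 1 \<partial>labeled_dist D \<psi>) = (\<integral>\<^sup>+ z. ennreal (f z + 1) \<partial>labeled_dist D \<psi>)"
    using intf f1 by (intro nn_integral_eq_integral[symmetric] AE_I2) (force simp: abs_le_iff)+
  also have "\<dots> = (\<integral>\<^sup>+ x. ennreal ((1 + \<psi> x) / 2) * ennreal (f (x, 1) + 1)
      + ennreal ((1 - \<psi> x) / 2) * ennreal (f (x, -1) + 1) \<partial>D)"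
    by (rule nn_integral_labeled_dist[OF psi]) measurable
  also have "\<dots> = (\<integral>\<^sup>+ x. ennreal (?h x + 1) \<partial>D)"
  proof (intro nn_integral_cong)
    fix x assume x: "x \<in> space D"
    have "ennreal ((1 + \<psi> x) / 2) * ennreal (f (x, 1) + 1)
        + ennreal ((1 - \<psi> x) / 2) * ennreal (f (x, -1) + 1)
        = ennreal ((1 + \<psi> x) / 2 * (f (x, 1) + 1) + (1 - \<psi> x) / 2 * (f (x, -1) + 1))"
      using bnd[OF x] f1[OF x, of 1] f1[OF x, of "-1"]
      by (subst (1 2) ennreal_mult[symmetric]) (auto simp: abs_le_iff intro!: ennreal_plus[symmetric] mult_nonneg_nonneg)
    also have "(1 + \<psi> x) / 2 * (f (x, 1) + 1) + (1 - \<psi> x) / 2 * (f (x, -1) + 1) = ?h x + 1"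
      by (simp add: field_simps)
    finally show "ennreal ((1 + \<psi> x) / 2) * ennreal (f (x, 1) + 1)
        + ennreal ((1 - \<psi> x) / 2) * ennreal (f (x, -1) + 1) = ennreal (?h x + 1)" .
  qed
  also have "\<dots> = ennreal (\<integral>x. ?h x + 1 \<partial>D)"
    using inth h1 by (intro nn_integral_eq_integral AE_I2) (force simp: abs_le_iff)+
  finally have "(\<integral>z. f z + 1 \<partial>labeled_dist D \<psi>) = (\<integral>x. ?h x + 1 \<partial>D)"
  proof (subst (asm) ennreal_inj)
    show "0 \<le> (\<integral>z. f z + 1 \<partial>labeled_dist D \<psi>)"
      using f1 by (intro integral_nonneg_AE AE_I2) (force simp: abs_le_iff)
    show "0 \<le> (\<integral>x. ?h x + 1 \<partial>D)"
      using h1 by (intro integral_nonneg_AE AE_I2) (force simp: abs_le_iff)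
  qed
  then show ?thesis
    using intf inth L.prob_space by (simp add: D.prob_space)
qed

section \<open>Answering a noisy query\<close>

text \<open>Estimating \<open>1 - 2 * \<eta>\<close> times the query, instead of the query, keeps the statistic in
  \<open>[-1, 1]\<close>.\<close>

definition rescaled :: "('x \<Rightarrow> real \<Rightarrow> real) \<Rightarrow> real \<Rightarrow> 'x \<Rightarrow> real \<Rightarrow> real" where
  "rescaled \<phi> \<eta> x l = (1 - 2 * \<eta>) * ((\<phi> x 1 + \<phi> x (-1)) / 2) + l * ((\<phi> x 1 - \<phi> x (-1)) / 2)"

definition jittered :: "real \<Rightarrow> real \<Rightarrow> real \<Rightarrow> real \<Rightarrow> real" where
  "jittered a R b T = T / a + R * (2 * b - 1)"

lemma measurable_jittered: "case_prod (jittered a R) \<in> borel_measurable (borel \<Otimes>\<^sub>M borel)"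
  unfolding jittered_def by measurable

lemma noisy_in_unit_interval:
  assumes "\<psi> x \<in> {-1..1}" "\<Lambda> x \<in> {0..1}"
  shows "noisy \<psi> \<Lambda> x \<in> {-1..1}"
proof -
  have "\<bar>\<psi> x\<bar> * \<bar>1 - 2 * \<Lambda> x\<bar> \<le> 1 * 1"
    using assms by (intro mult_mono) auto
  then show ?thesis
    by (simp add: noisy_def abs_le_iff flip: abs_mult)
qed

text \<open>The positivity of the mean of \<kappa> makes \<open>filtered D \<kappa>\<close> a
  probability measure. It holds whenever the query makes a demand, since then that mean is at least
  \<open>\<tau>\<^sub>0\<close>.\<close>

locale noisy_query = D: prob_space D
  for D :: "'x measure" +
  fixes \<psi> \<kappa> :: "'x \<Rightarrow> real" and \<phi> :: "'x \<Rightarrow> real \<Rightarrow> real" and \<Lambda> :: "'x \<Rightarrow> real" and \<eta> \<tau> :: real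
  assumes psi[measurable]: "\<psi> \<in> borel_measurable D" and psi_bounds: "x \<in> space D \<Longrightarrow> \<psi> x \<in> {-1..1}"
    and kappa[measurable]: "\<kappa> \<in> borel_measurable D" and kappa_bounds: "x \<in> space D \<Longrightarrow> \<kappa> x \<in> {0..1}"
    and phi: "case_prod \<phi> \<in> borel_measurable (D \<Otimes>\<^sub>M count_space {-1, 1})"
    and phi_bounds: "x \<in> space D \<Longrightarrow> l \<in> {-1, 1} \<Longrightarrow> \<phi> x l \<in> {-1..1}"
    and Lambda[measurable]: "\<Lambda> \<in> borel_measurable D" and Lambda_bounds: "x \<in> space D \<Longrightarrow> \<Lambda> x \<in> {0..1}"
    and eta: "0 \<le> \<eta>" "\<eta> < 1 / 2" and tau: "0 < \<tau>"
    and kappa_pos: "0 < (\<integral>x. \<kappa> x \<partial>D)"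
    and uncor: "uncorrelated \<eta> ((1 - 2 * \<eta>) * \<tau> / 4) \<phi> \<kappa> D \<psi> \<Lambda>"
begin

abbreviation "\<gamma> \<equiv> 1 - 2 * \<eta>"
abbreviation "g \<equiv> rescaled \<phi> \<eta>"
abbreviation "P \<equiv> labeled_dist D (noisy \<psi> \<Lambda>)"
abbreviation "F \<equiv> filtered D \<kappa>"
definition "target = (\<integral>(x, l). \<phi> x l \<partial>labeled_dist F \<psi>)"

lemma gamma: "0 < \<gamma>" "\<gamma> \<le> 1"
  using eta by auto

lemma phi_at[measurable]: "(\<lambda>x. \<phi> x 1) \<in> borel_measurable D" "(\<lambda>x. \<phi> x (-1)) \<in> borel_measurable D"
proof -
  have "(\<lambda>x. case_prod \<phi> (x, l)) \<in> borel_measurable D" if "l \<in> {-1, 1}" for l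
    using that by (intro measurable_compose[OF _ phi] measurable_Pair) auto
  from this[of 1] this[of "-1"]
  show "(\<lambda>x. \<phi> x 1) \<in> borel_measurable D" "(\<lambda>x. \<phi> x (-1)) \<in> borel_measurable D" by simp_all
qed

lemma noisy_measurable[measurable]: "noisy \<psi> \<Lambda> \<in> borel_measurable D"
  unfolding noisy_def by measurable

lemma noisy_bounds: "x \<in> space D \<Longrightarrow> noisy \<psi> \<Lambda> x \<in> {-1..1}"
  by (intro noisy_in_unit_interval psi_bounds Lambda_bounds)

lemma g_measurable[measurable]: "case_prod g \<in> borel_measurable (D \<Otimes>\<^sub>M count_space {-1, 1})"
proof -
  have [measurable]: "snd \<in> borel_measurable (D \<Otimes>\<^sub>M count_space {-1, 1::real})"
    using measurable_compose[OF measurable_snd, of "\<lambda>l. l" "count_space {-1, 1::real}" borel D]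
    by simp
  show ?thesis
    unfolding rescaled_def case_prod_beta by measurable
qed

text \<open>With \<open>a\<close> and \<open>b\<close> the values of \<phi> at the two labels, half
  of \<open>\<bar>a + b\<bar>\<close> plus half of \<open>\<bar>a - b\<bar>\<close> is the maximum
  of \<open>\<bar>a\<bar>\<close> and \<open>\<bar>b\<bar>\<close>; the factor \<gamma> only shrinks
  the first term.\<close>

lemma g_bounds:
  assumes x: "x \<in> space D" and l: "l \<in> {-1, 1}"
  shows "g x l \<in> {-1..1}"
proof -
  let ?A = "(\<phi> x 1 + \<phi> x (-1)) / 2" and ?B = "(\<phi> x 1 - \<phi> x (-1)) / 2"
  have "\<gamma> * \<bar>?A\<bar> \<le> 1 * \<bar>?A\<bar>"
    using gamma by (intro mult_right_mono) auto
  then have "\<bar>g x l\<bar> \<le> \<bar>?A\<bar> + \<bar>?B\<bar>"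
    using l gamma unfolding rescaled_def
    by (intro order_trans[OF abs_triangle_ineq]) (auto simp: abs_mult)
  also have "\<dots> \<le> 1"
    using phi_bounds[OF x, of 1] phi_bounds[OF x, of "-1"] by (auto simp: abs_if field_simps)
  finally show ?thesis by (simp add: abs_le_iff)
qed

lemma prob_space_P: "prob_space P"
  by (rule prob_space_labeled_dist[OF D.prob_space_axioms noisy_measurable noisy_bounds])

lemma sampling: "rejection_sampling P (\<kappa> \<circ> fst) (case_prod g)"
proof (intro rejection_sampling.intro rejection_sampling_axioms.intro prob_space_P)
  show "\<kappa> \<circ> fst \<in> borel_measurable P"
    by (simp add: measurable_cong_sets[OF sets_labeled_dist refl] measurable_compose[OF measurable_fst kappa] comp_def)
  show "case_prod g \<in> borel_measurable P"
    by (simp add: measurable_cong_sets[OF sets_labeled_dist refl])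
qed (use kappa_bounds g_bounds in auto)

lemma integral_filtered:
  assumes [measurable]: "f \<in> borel_measurable D"
  shows "(\<integral>x. f x \<partial>F) = (\<integral>x. \<kappa> x * f x \<partial>D) / (\<integral>x. \<kappa> x \<partial>D)"
proof -
  have "(\<integral>x. f x \<partial>F) = (\<integral>x. (\<kappa> x / (\<integral>x. \<kappa> x \<partial>D)) * f x \<partial>D)"
    unfolding filtered_def using kappa_bounds kappa_pos
    by (subst integral_density) (auto intro!: AE_I2 divide_nonneg_pos)
  then show ?thesis by simp
qed

lemma prob_space_filtered: "prob_space F"
proof (rule prob_spaceI)
  have int: "integrable D \<kappa>"
    using kappa_bounds by (intro D.integrable_const_bound[of _ 1]) auto
  have "emeasure F (space F) = (\<integral>\<^sup>+ x. ennreal (\<kappa> x / (\<integral>x. \<kappa> x \<partial>D)) \<partial>D)"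
    by (simp add: filtered_def emeasure_density cong: nn_integral_cong)
  also have "\<dots> = ennreal (\<integral>x. \<kappa> x / (\<integral>x. \<kappa> x \<partial>D) \<partial>D)"
    using kappa_bounds kappa_pos int by (intro nn_integral_eq_integral) (auto intro!: AE_I2 divide_nonneg_pos)
  finally show "emeasure F (space F) = 1"
    using kappa_pos by simp
qed

text \<open>The filter ignores the label, and the two label probabilities add up to 1.\<close>

lemma acceptance: "rejection_sampling.p P (\<kappa> \<circ> fst) = (\<integral>x. \<kappa> x \<partial>D)"
proof -
  have "(\<integral>z. (\<kappa> \<circ> fst) z \<partial>P) = (\<integral>x. (1 + noisy \<psi> \<Lambda> x) / 2 * (\<kappa> \<circ> fst) (x, 1 :: real)
      + (1 - noisy \<psi> \<Lambda> x) / 2 * (\<kappa> \<circ> fst) (x, -1 :: real) \<partial>D)"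
    using kappa_bounds
    by (intro integral_labeled_dist[where f = "\<kappa> \<circ> fst"] D.prob_space_axioms noisy_measurable noisy_bounds)
      (auto simp: comp_def)
  also have "\<dots> = (\<integral>x. \<kappa> x \<partial>D)"
    by (intro Bochner_Integration.integral_cong) (auto simp: field_simps)
  finally show ?thesis
    by (simp add: rejection_sampling.p_def[OF sampling])
qed

lemma target_eq: "target = (\<integral>x. (\<phi> x 1 + \<phi> x (-1)) / 2 + (\<phi> x 1 - \<phi> x (-1)) / 2 * \<psi> x \<partial>F)"
proof -
  have sF: "sets F = sets D" "space F = space D" by (simp_all add: filtered_def)
  have mF: "borel_measurable F = borel_measurable D" by (rule measurable_cong_sets[OF sF(1) refl])
  have mFF: "borel_measurable (F \<Otimes>\<^sub>M count_space {-1, 1}) = borel_measurable (D \<Otimes>\<^sub>M count_space {-1, 1::real})"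
    by (intro measurable_cong_sets sets_pair_measure_cong sF refl)
  have "target = (\<integral>x. (1 + \<psi> x) / 2 * case_prod \<phi> (x, 1) + (1 - \<psi> x) / 2 * case_prod \<phi> (x, -1) \<partial>F)"
    unfolding target_def using phi_bounds psi_bounds phi psi
    by (intro integral_labeled_dist prob_space_filtered) (auto simp: mF mFF sF abs_le_iff; force)+
  then show ?thesis by (simp add: field_simps)
qed

text \<open>Identifies the bias caused by noise that is not constant: for \<Lambda> equal to \<eta>
  everywhere, the rescaled statistic has mean exactly \<open>\<gamma> * target\<close>.\<close>

lemma mean_eq: "rejection_sampling.\<mu> P (\<kappa> \<circ> fst) (case_prod g) =
  \<gamma> * target - 2 * (\<integral>x. (\<phi> x 1 - \<phi> x (-1)) / 2 * \<psi> x * (\<Lambda> x - \<eta>) \<partial>F)"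
proof -
  interpret F: prob_space F by (rule prob_space_filtered)
  have sF: "sets F = sets D" "space F = space D" by (simp_all add: filtered_def)
  have mF: "borel_measurable F = borel_measurable D" by (rule measurable_cong_sets[OF sF(1) refl])
  let ?A = "\<lambda>x. (\<phi> x 1 + \<phi> x (-1)) / 2" and ?B = "\<lambda>x. (\<phi> x 1 - \<phi> x (-1)) / 2"
  have B: "\<bar>?B x * \<psi> x\<bar> \<le> 1" if x: "x \<in> space D" for x
  proof -
    have "\<bar>?B x\<bar> * \<bar>\<psi> x\<bar> \<le> 1 * 1"
      using phi_bounds[OF x, of 1] phi_bounds[OF x, of "-1"] psi_bounds[OF x] by (intro mult_mono) auto
    then show ?thesis by (simp add: abs_mult)
  qed
  have i1: "integrable F (\<lambda>x. ?A x + ?B x * \<psi> x)"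
  proof (rule F.integrable_const_bound[where B = 2])
    have "\<bar>?A x + ?B x * \<psi> x\<bar> \<le> 2" if x: "x \<in> space D" for x
    proof -
      have "\<bar>?A x\<bar> \<le> 1"
        using phi_bounds[OF x, of 1] phi_bounds[OF x, of "-1"] by (simp add: abs_le_iff)
      then show ?thesis
        using B[OF x] abs_triangle_ineq[of "?A x" "?B x * \<psi> x"] by linarith
    qed
    then show "AE x in F. norm (?A x + ?B x * \<psi> x) \<le> 2"
      by (intro AE_I2) (simp add: sF)
  qed (simp add: mF)
  have i2: "integrable F (\<lambda>x. ?B x * \<psi> x * (\<Lambda> x - \<eta>))"
  proof (rule F.integrable_const_bound[where B = 1])
    have "\<bar>?B x * \<psi> x * (\<Lambda> x - \<eta>)\<bar> \<le> 1" if x: "x \<in> space D" for x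
    proof -
      have "\<bar>?B x * \<psi> x\<bar> * \<bar>\<Lambda> x - \<eta>\<bar> \<le> 1 * 1"
        using B[OF x] Lambda_bounds[OF x] eta by (intro mult_mono) auto
      then show ?thesis by (simp add: abs_mult)
    qed
    then show "AE x in F. norm (?B x * \<psi> x * (\<Lambda> x - \<eta>)) \<le> 1"
      by (intro AE_I2) (simp add: sF)
  qed (simp add: mF)
  let ?\<nu> = "noisy \<psi> \<Lambda>"
  have kg: "\<bar>\<kappa> x * g x l\<bar> \<le> 1" if "x \<in> space D" "l \<in> {-1, 1}" for x l
  proof -
    have "\<bar>\<kappa> x\<bar> * \<bar>g x l\<bar> \<le> 1 * 1"
      using kappa_bounds[OF that(1)] g_bounds[OF that] by (intro mult_mono) auto
    then show ?thesis by (simp add: abs_mult)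
  qed
  have "(\<integral>z. (\<kappa> \<circ> fst) z * case_prod g z \<partial>P) =
      (\<integral>x. (1 + ?\<nu> x) / 2 * ((\<kappa> \<circ> fst) (x, 1 :: real) * case_prod g (x, 1))
        + (1 - ?\<nu> x) / 2 * ((\<kappa> \<circ> fst) (x, -1 :: real) * case_prod g (x, -1)) \<partial>D)"
    using kg
    by (intro integral_labeled_dist D.prob_space_axioms noisy_measurable noisy_bounds) (auto simp: comp_def)
  \<comment> \<open>The noise factor is split as
    \<open>1 - 2 * \<Lambda> x = \<gamma> - 2 * (\<Lambda> x - \<eta>)\<close>.\<close>
  also have "\<dots> = (\<integral>x. \<kappa> x * (\<gamma> * (?A x + ?B x * \<psi> x) - 2 * (?B x * \<psi> x * (\<Lambda> x - \<eta>))) \<partial>D)"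
    by (intro Bochner_Integration.integral_cong refl) (simp add: rescaled_def noisy_def field_simps)
  finally have "rejection_sampling.\<mu> P (\<kappa> \<circ> fst) (case_prod g) =
      (\<integral>x. \<gamma> * (?A x + ?B x * \<psi> x) - 2 * (?B x * \<psi> x * (\<Lambda> x - \<eta>)) \<partial>F)"
    by (subst integral_filtered) (simp_all add: rejection_sampling.\<mu>_def[OF sampling] acceptance)
  also have "\<dots> = \<gamma> * (\<integral>x. ?A x + ?B x * \<psi> x \<partial>F) - 2 * (\<integral>x. ?B x * \<psi> x * (\<Lambda> x - \<eta>) \<partial>F)"
    using i1 i2 by (subst Bochner_Integration.integral_diff)
      (simp_all only: integrable_mult_right integral_mult_right_zero)
  finally show ?thesis by (simp add: target_eq)
qed

lemma bias: "\<bar>rejection_sampling.\<mu> P (\<kappa> \<circ> fst) (case_prod g) / \<gamma> - target\<bar> \<le> \<tau> / 2"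
proof -
  let ?I = "\<integral>x. (\<phi> x 1 - \<phi> x (-1)) / 2 * \<psi> x * (\<Lambda> x - \<eta>) \<partial>F"
  have "rejection_sampling.\<mu> P (\<kappa> \<circ> fst) (case_prod g) / \<gamma> - target = - (2 * ?I / \<gamma>)"
    unfolding mean_eq using gamma by (simp add: diff_divide_distrib)
  then have "\<bar>rejection_sampling.\<mu> P (\<kappa> \<circ> fst) (case_prod g) / \<gamma> - target\<bar> = 2 * \<bar>?I\<bar> / \<gamma>"
    using gamma by simp
  also have "\<dots> \<le> 2 * (\<gamma> * \<tau> / 4) / \<gamma>"
    using uncor gamma(1) unfolding uncorrelated_def
    by (intro divide_right_mono mult_left_mono) simp_all
  also have "2 * (\<gamma> * \<tau> / 4) = \<gamma> * (\<tau> / 2)" by simp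
  also have "\<gamma> * (\<tau> / 2) / \<gamma> = \<tau> / 2"
    using gamma(1) by (metis less_irrefl nonzero_mult_div_cancel_left)
  finally show ?thesis .
qed

text \<open>Given \<open>x\<close>, the mean of \<phi> is a convex combination of its two values.
  The bound is what lets an answer near 0, or a uniform guess, succeed without samples.\<close>

lemma target_bounds: "\<bar>target\<bar> \<le> 1"
proof -
  interpret F: prob_space F by (rule prob_space_filtered)
  have sF: "space F = space D" by (simp add: filtered_def)
  have "\<bar>(\<phi> x 1 + \<phi> x (-1)) / 2 + (\<phi> x 1 - \<phi> x (-1)) / 2 * \<psi> x\<bar> \<le> 1" if x: "x \<in> space D" for x
  proof -
    have "(\<phi> x 1 + \<phi> x (-1)) / 2 + (\<phi> x 1 - \<phi> x (-1)) / 2 * \<psi> x =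
        (1 + \<psi> x) / 2 * \<phi> x 1 + (1 - \<psi> x) / 2 * \<phi> x (-1)"
      by (simp add: field_simps)
    also have "\<bar>\<dots>\<bar> \<le> (1 + \<psi> x) / 2 * \<bar>\<phi> x 1\<bar> + (1 - \<psi> x) / 2 * \<bar>\<phi> x (-1)\<bar>"
      using psi_bounds[OF x] by (intro order_trans[OF abs_triangle_ineq]) (simp add: abs_mult)
    also have "\<dots> \<le> (1 + \<psi> x) / 2 * 1 + (1 - \<psi> x) / 2 * 1"
      using psi_bounds[OF x] phi_bounds[OF x, of 1] phi_bounds[OF x, of "-1"]
      by (intro add_mono mult_left_mono) auto
    finally show ?thesis by (simp add: field_simps)
  qed
  then have "\<bar>target\<bar> \<le> (\<integral>x. 1 \<partial>F)"
    unfolding target_eq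
    by (intro order_trans[OF integral_abs_bound] integral_mono') (auto simp: sF)
  then show ?thesis by (simp add: F.prob_space)
qed

section \<open>Success probability of the estimator in each regime\<close>

abbreviation "correct alg \<equiv> measure (sampling_space P)
  {\<omega> \<in> space (sampling_space P). answer alg \<omega> \<in> {target - \<tau>..target + \<tau>}}"

lemma correct_estimator:
  assumes q: "0 \<le> q" and B: "B \<in> sets borel"
    and hit: "\<And>T. T \<in> B \<Longrightarrow> emeasure coin {b. \<bar>T / a + R * (2 * b - 1) - target\<bar> \<le> \<tau>} \<ge> ennreal q"
  shows "correct (estimator \<kappa> g m n (jittered a R)) \<ge>
    q * measure (sampling_space P) {\<omega> \<in> space (sampling_space P).
      snd (walk (\<kappa> \<circ> fst) (case_prod g) m n (0, 0) (fst \<omega>) (snd \<omega>)) \<in> B}"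
proof -
  interpret R: rejection_sampling P "\<kappa> \<circ> fst" "case_prod g" m by (rule sampling)
  have eq: "{b. jittered a R b T \<in> {target - \<tau>..target + \<tau>}} = {b. \<bar>T / a + R * (2 * b - 1) - target\<bar> \<le> \<tau>}" for T
    by (auto simp: jittered_def abs_le_iff)
  have ans: "answer (estimator \<kappa> g m n (jittered a R)) \<omega> =
      jittered a R (snd \<omega> 0) (snd (walk (\<kappa> \<circ> fst) (case_prod g) m n (0, 0) (fst \<omega>) (\<lambda>i. snd \<omega> (Suc i))))" for \<omega>
    using answer_estimator[of \<kappa> g m n "jittered a R" "fst \<omega>" "snd \<omega>"] by simp
  show ?thesis
    unfolding ans using hit by (intro R.prob_randomized_output measurable_jittered B q) (simp_all only: eq, simp)
qed

text \<open>Dividing the sum by \<open>m * \<gamma>\<close> turns a deviation \<rho> per accepted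
  point into \<open>\<rho> / \<gamma>\<close>, and \<open>bias\<close> adds \<tau> / 2. The number
  \<open>q\<close> is the chance that the jitter repairs an error of that size.\<close>

lemma correct_concentrated:
  assumes m: "0 < m" and n: "4 * real m \<le> real n * (\<integral>x. \<kappa> x \<partial>D)" and \<rho>: "0 < \<rho>" "\<rho> \<le> 1" and q: "0 \<le> q"
    and hit: "\<And>y. \<bar>y - target\<bar> \<le> \<rho> / \<gamma> + \<tau> / 2 \<Longrightarrow>
      emeasure coin {b. \<bar>y + R * (2 * b - 1) - target\<bar> \<le> \<tau>} \<ge> ennreal q"
  shows "correct (estimator \<kappa> g m n (jittered (m * \<gamma>) R)) \<ge> q * (1 - 3 * exp (- (m * \<rho>\<^sup>2 / 2)))"
proof -
  interpret R: rejection_sampling P "\<kappa> \<circ> fst" "case_prod g" m by (rule sampling)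
  let ?B = "{T. \<bar>T - m * R.\<mu>\<bar> \<le> m * \<rho>}"
  have "q * (1 - 3 * exp (- (m * \<rho>\<^sup>2 / 2))) \<le> q * R.\<Omega>.prob {\<omega> \<in> space R.\<Omega>.
      snd (walk (\<kappa> \<circ> fst) (case_prod g) m n (0, 0) (fst \<omega>) (snd \<omega>)) \<in> ?B}"
    using R.concentration[of \<rho> n] n \<rho> kappa_pos acceptance q
    by (intro mult_left_mono) (simp_all only: mem_Collect_eq)
  also have "\<dots> \<le> correct (estimator \<kappa> g m n (jittered (m * \<gamma>) R))"
  proof (intro correct_estimator q hit)
    fix T assume "T \<in> ?B"
    then have "\<bar>T - m * R.\<mu>\<bar> / (m * \<gamma>) \<le> m * \<rho> / (m * \<gamma>)"
      using gamma by (intro divide_right_mono) auto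
    then have "\<bar>(T - m * R.\<mu>) / (m * \<gamma>)\<bar> \<le> m * \<rho> / (m * \<gamma>)"
      using gamma by (simp add: abs_mult)
    moreover have "(T - m * R.\<mu>) / (m * \<gamma>) = T / (m * \<gamma>) - R.\<mu> / \<gamma>" "m * \<rho> / (m * \<gamma>) = \<rho> / \<gamma>"
      using m gamma by (simp_all add: diff_divide_distrib)
    ultimately have "\<bar>T / (m * \<gamma>) - R.\<mu> / \<gamma>\<bar> \<le> \<rho> / \<gamma>"
      by (simp only:)
    then show "\<bar>T / (m * \<gamma>) - target\<bar> \<le> \<rho> / \<gamma> + \<tau> / 2"
      using bias by linarith
  qed measurable
  finally show ?thesis .
qed

text \<open>With \<open>\<rho> = \<gamma> * \<tau> / 2\<close> the sampling error and the bias use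
  up half of \<tau> each. Jitter radius 0 makes the coin irrelevant, so \<open>q\<close> is
  1.\<close>

lemma correct_high_confidence:
  assumes "0 < m" "4 * real m \<le> real n * (\<integral>x. \<kappa> x \<partial>D)" "\<tau> \<le> 1"
  shows "correct (estimator \<kappa> g m n (jittered (m * \<gamma>) 0)) \<ge> 1 - 3 * exp (- (m * (\<gamma> * \<tau> / 2)\<^sup>2 / 2))"
proof -
  interpret C: prob_space coin by (rule prob_space_coin)
  have "\<gamma> * \<tau> \<le> 1 * 1" using assms(3) gamma tau by (intro mult_mono) auto
  moreover have "emeasure coin {b. \<bar>y + 0 * (2 * b - 1) - target\<bar> \<le> \<tau>} \<ge> ennreal 1"
    if "\<bar>y - target\<bar> \<le> \<gamma> * \<tau> / 2 / \<gamma> + \<tau> / 2" for y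
  proof -
    have "\<gamma> * \<tau> / 2 / \<gamma> = \<tau> / 2"
      using gamma(1) by (metis less_irrefl nonzero_mult_div_cancel_left times_divide_eq_right)
    then have "{b. \<bar>y + 0 * (2 * b - 1) - target\<bar> \<le> \<tau>} = space coin"
      using that by auto
    then show ?thesis
      by (simp only: C.emeasure_space_1) simp
  qed
  ultimately show ?thesis
    using correct_concentrated[of m n "\<gamma> * \<tau> / 2" 1 0] assms gamma tau
    by simp
qed

lemma correct_low_confidence:
  assumes "0 < m" "4 * real m \<le> real n * (\<integral>x. \<kappa> x \<partial>D)" "0 < \<rho>" "\<rho> \<le> 1" "\<rho> / \<gamma> + \<tau> / 2 \<le> R" "\<tau> \<le> R"
  shows "correct (estimator \<kappa> g m n (jittered (m * \<gamma>) R)) \<ge> \<tau> / (2 * R) * (1 - 3 * exp (- (m * \<rho>\<^sup>2 / 2)))"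
  using assms tau by (intro correct_concentrated emeasure_coin_window) auto

text \<open>With no draws the sum is 0, and \<open>0 / a = 0\<close> for every \<open>a\<close>,
  including the divisor 0 that an empty label budget produces. The output is then uniform on
  [-1, 1].\<close>

lemma correct_guess:
  assumes "\<tau> \<le> 1"
  shows "correct (estimator \<kappa> g m 0 (jittered a 1)) \<ge> \<tau> / 2"
proof -
  interpret R: rejection_sampling P "\<kappa> \<circ> fst" "case_prod g" m by (rule sampling)
  show ?thesis
    using correct_estimator[of "\<tau> / 2" "{0}" a 1 m 0] emeasure_coin_window[of 0 target 1 \<tau>] target_bounds assms tau
    by (simp add: R.\<Omega>.prob_space)
qed

lemma correct_trivial:
  assumes "1 \<le> \<tau>"
  shows "correct (estimator \<kappa> g m 0 (jittered a 0)) \<ge> 1"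
proof -
  interpret R: rejection_sampling P "\<kappa> \<circ> fst" "case_prod g" m by (rule sampling)
  interpret C: prob_space coin by (rule prob_space_coin)
  show ?thesis
    using correct_estimator[of 1 "{0}" a 0 m 0] C.emeasure_space_1 target_bounds assms
    by (simp add: R.\<Omega>.prob_space)
qed

end

section \<open>Budgets\<close>

text \<open>As \<open>\<delta>\<close> tends to 1 the allowed number of samples \<open>ln (1 / \<delta>)\<close>, up to a factor, tends to 0.
  For \<open>\<delta> > 3 / 4\<close> we therefore only estimate up to \<open>R = \<tau> / (4 * (1 - \<delta>))\<close>, with probability at
  least 1/2, and add uniform noise from \<open>[-R, R]\<close>: this lands within \<open>\<tau>\<close> of the target with
  probability at least \<open>\<tau> / (2 * R) = 2 * (1 - \<delta>)\<close>. If \<open>1 - \<delta> \<le> \<tau> / 2\<close>, a uniform guess from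
  \<open>[-1, 1]\<close> is good enough. If \<open>\<tau>\<^sub>0 > 1\<close> every answer is valid, and if \<open>\<tau> \<ge> 1\<close> the answer 0 is.\<close>

definition label_budget :: "real \<Rightarrow> real \<Rightarrow> real \<Rightarrow> real \<Rightarrow> nat" where
  "label_budget \<eta> \<tau>\<^sub>0 \<tau> \<delta> =
    (if 1 \<le> \<tau> \<or> 1 < \<tau>\<^sub>0 then 0
     else if \<delta> \<le> 3 / 4 then nat \<lceil>40 * ln (1 / \<delta>) / (\<tau>\<^sup>2 * (1 - 2 * \<eta>)\<^sup>2)\<rceil>
     else if 1 - \<delta> \<le> \<tau> / 2 then 0
     else nat \<lceil>256 * (1 - \<delta>)\<^sup>2 / (\<tau>\<^sup>2 * (1 - 2 * \<eta>)\<^sup>2)\<rceil>)"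

definition draw_budget :: "real \<Rightarrow> real \<Rightarrow> real \<Rightarrow> real \<Rightarrow> nat" where
  "draw_budget \<eta> \<tau>\<^sub>0 \<tau> \<delta> = nat \<lceil>4 * real (label_budget \<eta> \<tau>\<^sub>0 \<tau> \<delta>) / \<tau>\<^sub>0\<rceil>"

definition jitter :: "real \<Rightarrow> real \<Rightarrow> real" where
  "jitter \<tau> \<delta> =
    (if 1 \<le> \<tau> \<or> \<delta> \<le> 3 / 4 then 0
     else if 1 - \<delta> \<le> \<tau> / 2 then 1
     else \<tau> / (4 * (1 - \<delta>)))"

definition active_query :: "('x \<Rightarrow> real) \<Rightarrow> ('x \<Rightarrow> real \<Rightarrow> real) \<Rightarrow> real \<Rightarrow> real \<Rightarrow> real \<Rightarrow> real \<Rightarrow>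
  'x active_alg" where
  "active_query \<kappa> \<phi> \<eta> \<tau>\<^sub>0 \<tau> \<delta> =
    estimator \<kappa> (rescaled \<phi> \<eta>) (label_budget \<eta> \<tau>\<^sub>0 \<tau> \<delta>) (draw_budget \<eta> \<tau>\<^sub>0 \<tau> \<delta>)
      (jittered (real (label_budget \<eta> \<tau>\<^sub>0 \<tau> \<delta>) * (1 - 2 * \<eta>)) (jitter \<tau> \<delta>))"

section \<open>Rounding, logarithms and the constants\<close>

text \<open>Rounding up costs a factor 2 instead of an additive 1, for which the claimed bounds
  leave no room.\<close>

lemma nat_ceiling_bounds:
  assumes "1 \<le> (x :: real)"
  shows "x \<le> real (nat \<lceil>x\<rceil>)" "real (nat \<lceil>x\<rceil>) \<le> 2 * x"
  using assms by linarith+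

text \<open>The fourth power of 4/3 is 256/81, which exceeds 3. For \<delta> up to 3/4 this lets the
  factor 3 of the union bound be absorbed into a multiple of
  \<open>ln (1 / \<delta>)\<close>.\<close>

lemma ln_four_thirds: "4 * ln (4 / 3 :: real) \<ge> ln 3"
proof -
  have "ln 3 \<le> ln ((4 / 3 :: real) ^ 4)"
    by (subst ln_le_cancel_iff) (simp_all add: power_divide)
  then show ?thesis by (simp add: ln_realpow)
qed

lemma ln_3_ge_1: "1 \<le> ln (3 :: real)"
proof -
  have "exp 1 \<le> (3 :: real)" by (rule exp_le)
  then have "ln (exp 1) \<le> ln (3 :: real)" by (subst ln_le_cancel_iff) auto
  then show ?thesis by simp
qed

lemma ln_inverse_high_confidence:
  assumes "0 < \<delta>" "\<delta> \<le> 3 / 4"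
  shows "ln 3 \<le> 4 * ln (1 / \<delta> :: real)" "1 \<le> 4 * ln (1 / \<delta> :: real)"
proof -
  have "4 / 3 \<le> 1 / \<delta>" using assms by (simp add: field_simps)
  then have "ln (4 / 3) \<le> ln (1 / \<delta>)" using assms by (subst ln_le_cancel_iff) auto
  then show "ln 3 \<le> 4 * ln (1 / \<delta>)" "1 \<le> 4 * ln (1 / \<delta>)"
    using ln_four_thirds ln_3_ge_1 by linarith+
qed

lemma ln_inverse_ge: "0 < \<delta> \<Longrightarrow> 1 - \<delta> \<le> ln (1 / \<delta> :: real)"
  using ln_le_minus_one[of \<delta>] by (simp add: ln_div)

context
  fixes \<eta> \<tau>\<^sub>0 \<tau> \<delta> :: real
  assumes eta: "0 \<le> \<eta>" "\<eta> < 1 / 2" and tau0: "0 < \<tau>\<^sub>0" and tau: "0 < \<tau>" and delta: "0 < \<delta>" "\<delta> < 1"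
begin

lemma scale_bounds: "0 < \<tau>\<^sup>2 * (1 - 2 * \<eta>)\<^sup>2" "\<tau> \<le> 1 \<Longrightarrow> \<tau>\<^sup>2 * (1 - 2 * \<eta>)\<^sup>2 \<le> 1"
proof -
  show "0 < \<tau>\<^sup>2 * (1 - 2 * \<eta>)\<^sup>2" using eta tau by simp
  show "\<tau>\<^sup>2 * (1 - 2 * \<eta>)\<^sup>2 \<le> 1" if "\<tau> \<le> 1"
    using eta tau that by (intro mult_le_one power_le_one) auto
qed

text \<open>Here \<open>ln (1 / \<delta>)\<close> is at least 1/4 and the denominator at most 1, so
  the number before rounding is at least 10 and rounding at most doubles it.\<close>

lemma label_budget_high_confidence:
  assumes "\<tau> < 1" "\<tau>\<^sub>0 \<le> 1" "\<delta> \<le> 3 / 4"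
  shows "40 * ln (1 / \<delta>) / (\<tau>\<^sup>2 * (1 - 2 * \<eta>)\<^sup>2) \<le> label_budget \<eta> \<tau>\<^sub>0 \<tau> \<delta>"
    "label_budget \<eta> \<tau>\<^sub>0 \<tau> \<delta> \<le> 80 * ln (1 / \<delta>) / (\<tau>\<^sup>2 * (1 - 2 * \<eta>)\<^sup>2)"
    "0 < label_budget \<eta> \<tau>\<^sub>0 \<tau> \<delta>"
proof -
  let ?s = "\<tau>\<^sup>2 * (1 - 2 * \<eta>)\<^sup>2"
  have "1 * ?s \<le> 40 * ln (1 / \<delta>)"
    using scale_bounds assms ln_inverse_high_confidence(2)[OF delta(1) assms(3)] by linarith
  then have 1: "1 \<le> 40 * ln (1 / \<delta>) / ?s"
    using scale_bounds(1) by (simp only: pos_le_divide_eq)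
  have eq: "label_budget \<eta> \<tau>\<^sub>0 \<tau> \<delta> = nat \<lceil>40 * ln (1 / \<delta>) / ?s\<rceil>"
    using assms by (simp add: label_budget_def)
  show 2: "40 * ln (1 / \<delta>) / ?s \<le> label_budget \<eta> \<tau>\<^sub>0 \<tau> \<delta>"
    unfolding eq by (rule nat_ceiling_bounds[OF 1])
  show "label_budget \<eta> \<tau>\<^sub>0 \<tau> \<delta> \<le> 80 * ln (1 / \<delta>) / ?s"
    using nat_ceiling_bounds(2)[OF 1] unfolding eq by simp
  show "0 < label_budget \<eta> \<tau>\<^sub>0 \<tau> \<delta>"
    using 1 2 by linarith
qed

text \<open>Let \<epsilon> be \<open>1 - \<delta>\<close>. Since \<tau> is below
  \<open>2 * \<epsilon>\<close>, the denominator is at most \<open>4 * \<epsilon>^2\<close>, so the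
  number before rounding exceeds 1 and rounding at most doubles it. As \<epsilon> is below 1/4, the
  square in \<open>512 * \<epsilon>^2\<close> is at most \<open>\<epsilon> / 4\<close>, and
  \<open>\<epsilon> \<le> ln (1 / \<delta>)\<close> gives 128.\<close>

lemma label_budget_low_confidence:
  assumes "\<tau> < 1" "\<tau>\<^sub>0 \<le> 1" "3 / 4 < \<delta>" "\<tau> / 2 < 1 - \<delta>"
  shows "256 * (1 - \<delta>)\<^sup>2 / (\<tau>\<^sup>2 * (1 - 2 * \<eta>)\<^sup>2) \<le> label_budget \<eta> \<tau>\<^sub>0 \<tau> \<delta>"
    "label_budget \<eta> \<tau>\<^sub>0 \<tau> \<delta> \<le> 128 * ln (1 / \<delta>) / (\<tau>\<^sup>2 * (1 - 2 * \<eta>)\<^sup>2)"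
    "0 < label_budget \<eta> \<tau>\<^sub>0 \<tau> \<delta>"
proof -
  let ?s = "\<tau>\<^sup>2 * (1 - 2 * \<eta>)\<^sup>2"
  have "?s \<le> \<tau>\<^sup>2 * 1"
    using eta by (intro mult_left_mono power_le_one) auto
  also have "\<dots> \<le> (2 * (1 - \<delta>))\<^sup>2"
    using assms tau by (simp only: mult_1_right) (intro power_mono; simp)
  also have "\<dots> = 4 * (1 - \<delta>)\<^sup>2"
    by (subst power_mult_distrib) simp
  finally have "?s \<le> 4 * (1 - \<delta>)\<^sup>2" .
  then have "1 * ?s \<le> 256 * (1 - \<delta>)\<^sup>2"
    using zero_le_power2[of "1 - \<delta>"] by linarith
  then have 1: "1 \<le> 256 * (1 - \<delta>)\<^sup>2 / ?s"
    using scale_bounds(1) by (simp only: pos_le_divide_eq)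
  have eq: "label_budget \<eta> \<tau>\<^sub>0 \<tau> \<delta> = nat \<lceil>256 * (1 - \<delta>)\<^sup>2 / ?s\<rceil>"
    using assms by (simp add: label_budget_def)
  show 2: "256 * (1 - \<delta>)\<^sup>2 / ?s \<le> label_budget \<eta> \<tau>\<^sub>0 \<tau> \<delta>"
    unfolding eq by (rule nat_ceiling_bounds[OF 1])
  have "(1 - \<delta>)\<^sup>2 \<le> 1 / 4 * (1 - \<delta>)"
    unfolding power2_eq_square using assms delta by (intro mult_right_mono) auto
  then have "512 * (1 - \<delta>)\<^sup>2 \<le> 512 * (1 / 4 * (1 - \<delta>))"
    by (intro mult_left_mono) auto
  also have "\<dots> \<le> 128 * ln (1 / \<delta>)"
    using ln_inverse_ge[OF delta(1)] by simp
  finally have "512 * (1 - \<delta>)\<^sup>2 \<le> 128 * ln (1 / \<delta>)" .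
  then have "512 * (1 - \<delta>)\<^sup>2 / ?s \<le> 128 * ln (1 / \<delta>) / ?s"
    using scale_bounds(1) by (intro divide_right_mono) auto
  then show "label_budget \<eta> \<tau>\<^sub>0 \<tau> \<delta> \<le> 128 * ln (1 / \<delta>) / ?s"
    using nat_ceiling_bounds(2)[OF 1] unfolding eq by linarith
  show "0 < label_budget \<eta> \<tau>\<^sub>0 \<tau> \<delta>"
    using 1 2 by linarith
qed

lemma label_budget_le: "label_budget \<eta> \<tau>\<^sub>0 \<tau> \<delta> \<le> 128 * ln (1 / \<delta>) / (\<tau>\<^sup>2 * (1 - 2 * \<eta>)\<^sup>2)"
proof -
  let ?s = "\<tau>\<^sup>2 * (1 - 2 * \<eta>)\<^sup>2"
  have L: "0 \<le> ln (1 / \<delta>)" using delta by simp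
  have mono: "80 * ln (1 / \<delta>) / ?s \<le> 128 * ln (1 / \<delta>) / ?s" "0 \<le> 128 * ln (1 / \<delta>) / ?s"
    using L scale_bounds(1) by (intro divide_right_mono divide_nonneg_pos; simp)+
  consider "1 \<le> \<tau> \<or> 1 < \<tau>\<^sub>0" | "\<tau> < 1" "\<tau>\<^sub>0 \<le> 1" "\<delta> \<le> 3 / 4"
    | "3 / 4 < \<delta>" "1 - \<delta> \<le> \<tau> / 2" | "\<tau> < 1" "\<tau>\<^sub>0 \<le> 1" "3 / 4 < \<delta>" "\<tau> / 2 < 1 - \<delta>"
    by linarith
  then show ?thesis
  proof cases
    case 2
    then show ?thesis using label_budget_high_confidence(2) mono by linarith
  next
    case 4
    then show ?thesis by (rule label_budget_low_confidence)
  qed (use mono(2) in \<open>simp_all add: label_budget_def\<close>)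
qed

lemma draw_budget_ge: "4 * real (label_budget \<eta> \<tau>\<^sub>0 \<tau> \<delta>) \<le> real (draw_budget \<eta> \<tau>\<^sub>0 \<tau> \<delta>) * \<tau>\<^sub>0"
proof -
  have "4 * real (label_budget \<eta> \<tau>\<^sub>0 \<tau> \<delta>) / \<tau>\<^sub>0 \<le> real (draw_budget \<eta> \<tau>\<^sub>0 \<tau> \<delta>)"
    unfolding draw_budget_def by linarith
  then show ?thesis using tau0 by (simp add: pos_divide_le_eq)
qed

text \<open>The constant is 128 from the label budget, times 4 draws per label, times 2 for
  rounding. A nonempty budget entails \<open>\<tau>\<^sub>0 \<le> 1\<close>, so there is at least 1
  to round.\<close>

lemma draw_budget_le: "draw_budget \<eta> \<tau>\<^sub>0 \<tau> \<delta> \<le> 1024 * ln (1 / \<delta>) / (\<tau>\<^sub>0 * (\<tau>\<^sup>2 * (1 - 2 * \<eta>)\<^sup>2))"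
proof (cases "label_budget \<eta> \<tau>\<^sub>0 \<tau> \<delta> = 0")
  case True
  have "0 \<le> 1024 * ln (1 / \<delta>) / (\<tau>\<^sub>0 * (\<tau>\<^sup>2 * (1 - 2 * \<eta>)\<^sup>2))"
    using delta scale_bounds(1) tau0 by (intro divide_nonneg_pos) simp_all
  with True show ?thesis by (simp add: draw_budget_def)
next
  case False
  let ?m = "real (label_budget \<eta> \<tau>\<^sub>0 \<tau> \<delta>)"
  have "\<tau>\<^sub>0 \<le> 1" using False by (auto simp: label_budget_def split: if_splits)
  moreover have "1 \<le> ?m" using False by simp
  ultimately have "1 \<le> 4 * ?m / \<tau>\<^sub>0" using tau0 by (simp add: pos_le_divide_eq)
  then have "draw_budget \<eta> \<tau>\<^sub>0 \<tau> \<delta> \<le> 2 * (4 * ?m / \<tau>\<^sub>0)"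
    unfolding draw_budget_def by (rule nat_ceiling_bounds)
  also have "\<dots> = 8 * ?m / \<tau>\<^sub>0" by simp
  also have "\<dots> \<le> 8 * (128 * ln (1 / \<delta>) / (\<tau>\<^sup>2 * (1 - 2 * \<eta>)\<^sup>2)) / \<tau>\<^sub>0"
    using label_budget_le tau0 by (intro divide_right_mono mult_left_mono) auto
  also have "\<dots> = 1024 * ln (1 / \<delta>) / (\<tau>\<^sub>0 * (\<tau>\<^sup>2 * (1 - 2 * \<eta>)\<^sup>2))"
    by simp
  finally show ?thesis .
qed

lemma label_requests_active_query:
  "real (label_requests (active_query \<kappa> \<phi> \<eta> \<tau>\<^sub>0 \<tau> \<delta>) \<omega>)
    \<le> 1024 * (1 / (\<tau>\<^sup>2 * (1 - 2 * \<eta>)\<^sup>2)) * ln (1 / \<delta>)"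
proof -
  have "real (label_requests (active_query \<kappa> \<phi> \<eta> \<tau>\<^sub>0 \<tau> \<delta>) \<omega>) \<le> label_budget \<eta> \<tau>\<^sub>0 \<tau> \<delta>"
    unfolding active_query_def by (simp only: of_nat_le_iff requests_estimator)
  also have "\<dots> \<le> 128 * ln (1 / \<delta>) / (\<tau>\<^sup>2 * (1 - 2 * \<eta>)\<^sup>2)" by (rule label_budget_le)
  also have "\<dots> \<le> 1024 * ln (1 / \<delta>) / (\<tau>\<^sup>2 * (1 - 2 * \<eta>)\<^sup>2)"
    using scale_bounds(1) delta by (intro divide_right_mono) auto
  finally show ?thesis by simp
qed

lemma draws_active_query:
  "real (draws (active_query \<kappa> \<phi> \<eta> \<tau>\<^sub>0 \<tau> \<delta>) \<omega>)
    \<le> 1024 * (1 / (\<tau>\<^sub>0 * \<tau>\<^sup>2 * (1 - 2 * \<eta>)\<^sup>2)) * ln (1 / \<delta>)"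
  using draw_budget_le by (simp add: active_query_def draws_estimator mult.assoc)

section \<open>Correctness when the filter is likely enough\<close>

lemma active_query_correct:
  fixes D :: "'x measure"
  assumes Q: "noisy_query D \<psi> \<kappa> \<phi> \<Lambda> \<eta> \<tau>" and tau0_le: "\<tau>\<^sub>0 \<le> (\<integral>x. \<kappa> x \<partial>D)"
  shows "noisy_query.correct D \<psi> \<kappa> \<phi> \<Lambda> \<tau> (active_query \<kappa> \<phi> \<eta> \<tau>\<^sub>0 \<tau> \<delta>) \<ge> 1 - \<delta>"
proof -
  interpret noisy_query D \<psi> \<kappa> \<phi> \<Lambda> \<eta> \<tau> by fact
  let ?m = "label_budget \<eta> \<tau>\<^sub>0 \<tau> \<delta>" and ?n = "draw_budget \<eta> \<tau>\<^sub>0 \<tau> \<delta>"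
  let ?p = "\<integral>x. \<kappa> x \<partial>D" and ?s = "\<tau>\<^sup>2 * (1 - 2 * \<eta>)\<^sup>2"
  have "?p \<le> 1"
    using rejection_sampling.acceptance_bounds(2)[OF sampling] acceptance by simp
  \<comment> \<open>This excludes the branch of the budget in which \<open>\<tau>\<^sub>0\<close>
    exceeds 1.\<close>
  then have tau01: "\<tau>\<^sub>0 \<le> 1" using tau0_le by simp
  have "real ?n * \<tau>\<^sub>0 \<le> real ?n * ?p" using tau0_le by (intro mult_left_mono) auto
  then have n: "4 * real ?m \<le> real ?n * ?p" using draw_budget_ge by linarith
  have s: "0 < ?s" by (rule scale_bounds)
  consider "1 \<le> \<tau>" | "\<tau> < 1" "\<delta> \<le> 3 / 4" | "\<tau> < 1" "3 / 4 < \<delta>" "1 - \<delta> \<le> \<tau> / 2"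
    | "\<tau> < 1" "3 / 4 < \<delta>" "\<tau> / 2 < 1 - \<delta>"
    by linarith
  then show ?thesis
  proof cases
    case 1
    then have *: "?m = 0" "?n = 0" "jitter \<tau> \<delta> = 0"
      by (simp_all add: draw_budget_def label_budget_def jitter_def)
    have "correct (active_query \<kappa> \<phi> \<eta> \<tau>\<^sub>0 \<tau> \<delta>) \<ge> 1"
      unfolding active_query_def * by (rule correct_trivial[OF 1])
    then show ?thesis using delta by linarith
  next
    case 2
    note budget = label_budget_high_confidence[OF 2(1) tau01 2(2)]
    have j: "jitter \<tau> \<delta> = 0" using 2 by (simp add: jitter_def)
    have "40 * ln (1 / \<delta>) \<le> ?m * ?s"
      using budget(1) s by (simp only: pos_divide_le_eq)
    \<comment> \<open>The right side is \<open>?m * ?s / 8\<close>, hence at least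
      \<open>5 * ln (1 / \<delta>)\<close>; four of the five copies pay for \<open>ln 3\<close>.
      This is the origin of 40.\<close>
    then have "ln 3 + ln (1 / \<delta>) \<le> ?m * (\<gamma> * \<tau> / 2)\<^sup>2 / 2"
      using ln_inverse_high_confidence(1)[OF delta(1) 2(2)]
      by (simp add: power_mult_distrib power_divide mult_ac)
    then have "exp (- (?m * (\<gamma> * \<tau> / 2)\<^sup>2 / 2)) \<le> exp (- (ln 3 + ln (1 / \<delta>)))"
      by simp
    also have "\<dots> = \<delta> / 3"
      unfolding exp_minus exp_add using delta by simp
    finally show ?thesis
      unfolding active_query_def j
      using correct_high_confidence[OF budget(3) n] 2 by linarith
  next
    case 3
    then have *: "?m = 0" "?n = 0" "jitter \<tau> \<delta> = 1"
      by (simp_all add: draw_budget_def label_budget_def jitter_def)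
    have "correct (active_query \<kappa> \<phi> \<eta> \<tau>\<^sub>0 \<tau> \<delta>) \<ge> \<tau> / 2"
      unfolding active_query_def * using 3 by (intro correct_guess) simp
    then show ?thesis using 3 by linarith
  next
    case 4
    note budget = label_budget_low_confidence[OF 4(1) tau01 4(2,3)]
    define \<epsilon> where "\<epsilon> = 1 - \<delta>"
    have \<epsilon>: "0 < \<epsilon>" "\<epsilon> < 1 / 4" "\<tau> < 2 * \<epsilon>" using delta 4 by (auto simp: \<epsilon>_def)
    \<comment> \<open>With the jitter radius \<open>R = \<tau> / (4 * \<epsilon>)\<close>, this
      makes \<open>\<rho> / \<gamma>\<close> equal to \<open>R / 2\<close>. The other half of
      \<open>R\<close> covers the bias \<tau> / 2, because \<epsilon> below 1/4 gives
      \<open>\<tau> \<le> R\<close>.\<close>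
    define \<rho> where "\<rho> = \<gamma> * \<tau> / (8 * \<epsilon>)"
    have j: "jitter \<tau> \<delta> = \<tau> / (4 * \<epsilon>)" using 4 by (simp add: jitter_def \<epsilon>_def)
    have "\<gamma> * \<tau> \<le> 1 * \<tau>" using gamma tau by (intro mult_right_mono) auto
    then have "\<rho> \<le> 1" using \<epsilon> by (simp add: \<rho>_def)
    moreover have "0 < \<rho>" using gamma tau \<epsilon> by (simp add: \<rho>_def)
    moreover have "\<tau> \<le> \<tau> / (4 * \<epsilon>)"
      using tau \<epsilon> by (simp add: pos_le_divide_eq)
    moreover have "\<rho> / \<gamma> + \<tau> / 2 \<le> \<tau> / (4 * \<epsilon>)"
    proof -
      have "\<rho> = \<gamma> * (\<tau> / (8 * \<epsilon>))" by (simp add: \<rho>_def)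
      then have "\<rho> / \<gamma> = \<tau> / (8 * \<epsilon>)"
        using gamma(1) by (metis less_irrefl nonzero_mult_div_cancel_left)
      also have "\<dots> = \<tau> / (4 * \<epsilon>) / 2" by simp
      finally have "\<rho> / \<gamma> = \<tau> / (4 * \<epsilon>) / 2" .
      moreover have "y / 2 + \<tau> / 2 \<le> y" if "\<tau> \<le> y" for y
        using that by simp
      ultimately show ?thesis using \<open>\<tau> \<le> \<tau> / (4 * \<epsilon>)\<close> by metis
    qed
    ultimately have "correct (active_query \<kappa> \<phi> \<eta> \<tau>\<^sub>0 \<tau> \<delta>) \<ge>
        \<tau> / (2 * (\<tau> / (4 * \<epsilon>))) * (1 - 3 * exp (- (?m * \<rho>\<^sup>2 / 2)))"
      unfolding active_query_def j by (intro correct_low_confidence budget n)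
    moreover have "\<tau> / (2 * (\<tau> / (4 * \<epsilon>))) = 2 * \<epsilon>" using tau \<epsilon> by simp
    \<comment> \<open>The factor 256 in the budget makes the exponent at least 2. Then the failure
      probability \<open>3 * exp (- 2)\<close> is at most 1/2, and the window probability
      \<open>2 * \<epsilon>\<close> is halved to exactly the required \<epsilon>.\<close>
    moreover have "exp (- (?m * \<rho>\<^sup>2 / 2)) \<le> 1 / 6"
    proof -
      have "256 * \<epsilon>\<^sup>2 \<le> ?m * ?s"
        using budget(1) s by (simp only: pos_divide_le_eq \<epsilon>_def)
      then have "2 \<le> ?m * ?s / (128 * \<epsilon>\<^sup>2)"
        using \<epsilon> by (subst pos_le_divide_eq) simp_all
      also have "\<dots> = ?m * \<rho>\<^sup>2 / 2"
        unfolding \<rho>_def power_divide power_mult_distrib by (simp add: mult.commute)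
      finally have "2 \<le> ?m * \<rho>\<^sup>2 / 2" .
      then have "exp (- (?m * \<rho>\<^sup>2 / 2)) \<le> exp (- 2)" by simp
      also have "\<dots> \<le> 1 / 6"
      proof -
        \<comment> \<open>The 20th power of 1.1 is about 6.7.\<close>
        have "6 \<le> (1 + 2 / real 20 :: real) ^ 20" by (simp add: power_divide)
        also have "\<dots> \<le> exp 2" by (rule exp_ge_one_plus_x_over_n_power_n) auto
        finally show ?thesis by (simp add: exp_minus field_simps)
      qed
      finally show ?thesis .
    qed
    then have "2 * \<epsilon> * (1 / 2) \<le> 2 * \<epsilon> * (1 - 3 * exp (- (?m * \<rho>\<^sup>2 / 2)))"
      using \<epsilon> by (intro mult_left_mono) auto
    ultimately show ?thesis by (simp add: \<epsilon>_def)
  qed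
qed

end

theorem theorem2p5:
  shows "\<exists>C > 0. \<exists>A :: ('x \<Rightarrow> real) \<Rightarrow> ('x \<Rightarrow> real \<Rightarrow> real) \<Rightarrow>
           real \<Rightarrow> real \<Rightarrow> real \<Rightarrow> real \<Rightarrow> 'x active_alg.
     \<forall>(D :: 'x measure) \<psi> \<kappa> \<phi> \<Lambda> \<eta> \<tau>\<^sub>0 \<tau> \<delta>.
       prob_space D \<and>
       \<psi> \<in> borel_measurable D \<and> (\<forall>x\<in>space D. \<psi> x \<in> {-1..1}) \<and>
       \<kappa> \<in> borel_measurable D \<and> (\<forall>x\<in>space D. \<kappa> x \<in> {0..1}) \<and>
       case_prod \<phi> \<in> borel_measurable (D \<Otimes>\<^sub>M count_space {-1, 1}) \<and>
       (\<forall>x\<in>space D. \<forall>l\<in>{-1, 1}. \<phi> x l \<in> {-1..1}) \<and>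
       \<Lambda> \<in> borel_measurable D \<and> (\<forall>x\<in>space D. \<Lambda> x \<in> {0..1}) \<and>
       0 \<le> \<eta> \<and> \<eta> < 1/2 \<and> 0 < \<tau>\<^sub>0 \<and> 0 < \<tau> \<and> 0 < \<delta> \<and> \<delta> < 1 \<and>
       uncorrelated \<eta> ((1 - 2 * \<eta>) * \<tau> / 4) \<phi> \<kappa> D \<psi> \<Lambda> \<longrightarrow>
       measure (sampling_space (labeled_dist D (noisy \<psi> \<Lambda>)))
         {\<omega> \<in> space (sampling_space (labeled_dist D (noisy \<psi> \<Lambda>))).
            valid_response D \<psi> \<kappa> \<phi> \<tau>\<^sub>0 \<tau> (answer (A \<kappa> \<phi> \<eta> \<tau>\<^sub>0 \<tau> \<delta>) \<omega>)} \<ge> 1 - \<delta> \<and>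
       (\<forall>\<omega>. real (label_requests (A \<kappa> \<phi> \<eta> \<tau>\<^sub>0 \<tau> \<delta>) \<omega>)
              \<le> C * (1 / (\<tau>^2 * (1 - 2 * \<eta>)^2)) * ln (1 / \<delta>)) \<and>
       (\<forall>\<omega>. real (draws (A \<kappa> \<phi> \<eta> \<tau>\<^sub>0 \<tau> \<delta>) \<omega>)
              \<le> C * (1 / (\<tau>\<^sub>0 * \<tau>^2 * (1 - 2 * \<eta>)^2)) * ln (1 / \<delta>))"
proof (intro exI[of _ "1024 :: real"] exI[of _ active_query] conjI[of "0 < (1024 :: real)"] allI impI)
  fix D :: "'x measure" and \<psi> \<kappa> :: "'x \<Rightarrow> real" and \<phi> :: "'x \<Rightarrow> real \<Rightarrow> real" and \<Lambda> :: "'x \<Rightarrow> real"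
    and \<eta> \<tau>\<^sub>0 \<tau> \<delta> :: real
  assume H: "prob_space D \<and>
       \<psi> \<in> borel_measurable D \<and> (\<forall>x\<in>space D. \<psi> x \<in> {-1..1}) \<and>
       \<kappa> \<in> borel_measurable D \<and> (\<forall>x\<in>space D. \<kappa> x \<in> {0..1}) \<and>
       case_prod \<phi> \<in> borel_measurable (D \<Otimes>\<^sub>M count_space {-1, 1}) \<and>
       (\<forall>x\<in>space D. \<forall>l\<in>{-1, 1}. \<phi> x l \<in> {-1..1}) \<and>
       \<Lambda> \<in> borel_measurable D \<and> (\<forall>x\<in>space D. \<Lambda> x \<in> {0..1}) \<and>
       0 \<le> \<eta> \<and> \<eta> < 1/2 \<and> 0 < \<tau>\<^sub>0 \<and> 0 < \<tau> \<and> 0 < \<delta> \<and> \<delta> < 1 \<and>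
       uncorrelated \<eta> ((1 - 2 * \<eta>) * \<tau> / 4) \<phi> \<kappa> D \<psi> \<Lambda>"
  let ?Z = "sampling_space (labeled_dist D (noisy \<psi> \<Lambda>))" and ?alg = "active_query \<kappa> \<phi> \<eta> \<tau>\<^sub>0 \<tau> \<delta>"
  let ?E = "{\<omega> \<in> space ?Z. valid_response D \<psi> \<kappa> \<phi> \<tau>\<^sub>0 \<tau> (answer ?alg \<omega>)}"
  have par: "0 \<le> \<eta>" "\<eta> < 1 / 2" "0 < \<tau>\<^sub>0" "0 < \<tau>" "0 < \<delta>" "\<delta> < 1" using H by auto
  have "1 - \<delta> \<le> measure ?Z ?E"
  proof (cases "\<tau>\<^sub>0 \<le> (\<integral>x. \<kappa> x \<partial>D)")
    case True
    have Q: "noisy_query D \<psi> \<kappa> \<phi> \<Lambda> \<eta> \<tau>"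
      using H True by (intro noisy_query.intro noisy_query_axioms.intro) auto
    have "valid_response D \<psi> \<kappa> \<phi> \<tau>\<^sub>0 \<tau> y \<longleftrightarrow>
        y \<in> {noisy_query.target D \<psi> \<kappa> \<phi> - \<tau>..noisy_query.target D \<psi> \<kappa> \<phi> + \<tau>}" for y
      using True by (auto simp: valid_response_def noisy_query.target_def[OF Q] abs_le_iff)
    then show ?thesis
      using active_query_correct[OF par Q True] by simp
  next
    \<comment> \<open>Now \<open>valid_response\<close> demands nothing, so the event is the whole
      sample space and only its total mass 1 is needed.\<close>
    case False
    have bnd: "noisy \<psi> \<Lambda> x \<in> {-1..1}" if "x \<in> space D" for x
      using H that by (intro noisy_in_unit_interval) auto
    have "noisy \<psi> \<Lambda> \<in> borel_measurable D"
      using H unfolding noisy_def by (intro borel_measurable_times borel_measurable_diff) auto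
    then have "prob_space ?Z"
      using H bnd by (intro prob_space_sampling_space prob_space_labeled_dist) auto
    then show ?thesis
      using False par by (simp add: valid_response_def prob_space.prob_space)
  qed
  then show "measure ?Z ?E \<ge> 1 - \<delta> \<and>
       (\<forall>\<omega>. real (label_requests ?alg \<omega>) \<le> 1024 * (1 / (\<tau>^2 * (1 - 2 * \<eta>)^2)) * ln (1 / \<delta>)) \<and>
       (\<forall>\<omega>. real (draws ?alg \<omega>) \<le> 1024 * (1 / (\<tau>\<^sub>0 * \<tau>^2 * (1 - 2 * \<eta>)^2)) * ln (1 / \<delta>))"
    using label_requests_active_query[OF par] draws_active_query[OF par] by blast
qed simp

end
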